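(* Let $p>3$ be a prime, let $q\ge3$ be an integer and let $\rho\in\mathbb{Q}_p$, with $|\rho|_p\le p^{-2}$ and $|q|_p\le p^{-2}$. Then for the $q$-state $p$-adic Potts model on the Cayley tree of order three, there exist two translation-invariant generalized $p$-adic quasi Gibbs measures in each of the following cases: (i) $p=11$; (ii) $p=19$; (iii) $p\ne 11,19$ and $D_0u_{p-2}^2\not\equiv 0\pmod p$ and $D_0u_{p-2}^2\not\equiv 9a_0^2\pmod p$, where $a_0,b_0\in\{1,2,\dots,p-1\}$, $a_0\equiv-4/3\pmod p$, $b_0\equiv-38/27\pmod p$, $D_0=-4a_0^3-27b_0^2$, and $u_{n+3}=b_0u_n-a_0u_{n+1}$ ($n\ge1$) with $u_1=0$, $u_2=-a_0$, $u_3=b_0$.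
   Context: $\mathbb{Q}_p$ is the field of $p$-adic numbers with norm $|\cdot|_p$, $|p|_p=1/p$. Tree. $\Gamma^3_+=(V,L)$ is the semi-infinite Cayley tree of order three with root $x^0$: the infinite rooted tree in which every vertex has exactly three direct successors. $W_n$ is the set of vertices at distance $n$ from $x^0$, $V_n=\bigcup_{m=0}^n W_m$, and $L_n$ is the set of edges $\langle x,y\rangle$ with $x,y\in V_n$. Potts model. The state space is $\Phi=\{0,1,\dots,q-1\}$, and $\Omega=\Phi^V$, $\Omega_{V_n}=\Phi^{V_n}$, $\Omega_{W_n}=\Phi^{W_n}$. The Hamiltonian is $H_n(\sigma)=\sum_{\langle x,y\rangle\in L_n}\delta_{\sigma(x),\sigma(y)}$ for $\sigma\in\Omega_{V_n}$ ($\delta$ is the Kronecker symbol). Measures. A $p$-adic (probability) measure is a finitely additive $\mathbb{Q}_p$-valued function on an algebra of sets (with total mass $1$). Given $\rho\in\mathbb{Q}_p$ and a function $\mathbf{h}:V\setminus\{x^0\}\to\mathbb{Q}_p^{\Phi}$, $\mathbf{h}_x=(h_{0,x},\dots,h_{q-1,x})$, normalized (without loss of generality) by $h_{0,x}=1$, define for $n\ge 1$ and $\sigma\in\Omega_{V_n}$ $$\mu^{(n)}_{\mathbf{h},\rho}(\sigma)=\frac{1}{Z^{(\mathbf{h})}_{n,\rho}}\,\rho^{H_n(\sigma)}\prod_{x\in W_n}h_{\sigma(x),x},\qquad Z^{(\mathbf{h})}_{n,\rho}=\sum_{\sigma\in\Omega_{V_n}}\rho^{H_n(\sigma)}\prod_{x\in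 W_n}h_{\sigma(x),x}.$$ If these are compatible, i.e. $\sum_{\omega\in\Omega_{W_n}}\mu^{(n)}_{\mathbf{h},\rho}(\sigma_{n-1}\vee\omega)=\mu^{(n-1)}_{\mathbf{h},\rho}(\sigma_{n-1})$ for all $n\geq 2$ and $\sigma_{n-1}\in\Omega_{V_{n-1}}$ (where $\sigma_{n-1}\vee\omega$ is the concatenated configuration on $V_n$), then there is a unique $p$-adic probability measure $\mu_{\mathbf{h},\rho}$ on the algebra of cylinder subsets of $\Omega$ with $\mu_{\mathbf{h},\rho}(\{\sigma:\sigma|_{V_n}=\sigma_n\})=\mu^{(n)}_{\mathbf{h},\rho}(\sigma_n)$ for all $n\ge1$, $\sigma_n\in\Omega_{V_n}$. Such $\mu_{\mathbf{h},\rho}$ is called a generalized $p$-adic quasi Gibbs measure. It is called translation-invariant if $\mathbf{h}_x$ does not depend on $x\in V\setminus\{x^0\}$. *)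

theory Defs
  imports
    "HOL-Analysis.Analysis"
    "HOL-Library.Numeral_Type"
    "HOL-Number_Theory.Cong"
    "Berlekamp_Zassenhaus.Finite_Field"
begin

section \<open>The p-adic absolute value on the rationals\<close>

definition padic_val :: "nat \<Rightarrow> rat \<Rightarrow> int" where
  "padic_val p r =
     int (multiplicity (int p) (fst (quotient_of r))) - int (multiplicity (int p) (snd (quotient_of r)))"

definition padic_abs :: "nat \<Rightarrow> rat \<Rightarrow> real" where
  "padic_abs p r = (if r = 0 then 0 else real p powi (- padic_val p r))"

lemma padic_abs_0 [simp]: "padic_abs p 0 = 0"
  by (simp add: padic_abs_def)

context
  fixes p :: nat
  assumes p: "prime p"
begin

lemma padic_val_frac:
  assumes "a \<noteq> 0" "b \<noteq> 0"
  shows "padic_val p (of_int a / of_int b) = int (multiplicity (int p) a) - int (multiplicity (int p) b)"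
proof -
  obtain c d where cd: "quotient_of (of_int a / of_int b) = (c, d)" by fastforce
  have d: "d > 0" using quotient_of_denom_pos[OF cd] .
  have eq: "of_int a / of_int b = (of_int c / of_int d :: rat)" using quotient_of_div[OF cd] .
  hence c: "c \<noteq> 0" using assms d by auto
  have "(of_int (a * d) :: rat) = of_int (c * b)" using eq assms d by (simp add: field_simps)
  hence "a * d = c * b" by (simp only: of_int_eq_iff)
  hence "multiplicity (int p) (a * d) = multiplicity (int p) (c * b)" by simp
  moreover have "prime_elem (int p)" using p by auto
  ultimately have "multiplicity (int p) a + multiplicity (int p) d = multiplicity (int p) c + multiplicity (int p) b"
    using assms c d by (simp add: prime_elem_multiplicity_mult_distrib)
  thus ?thesis unfolding padic_val_def cd by simp
qed

lemma rat_frac_cases: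
  fixes x y :: rat
  obtains a b c where "c \<noteq> 0" "x = of_int a / of_int c" "y = of_int b / of_int c"
proof -
  obtain a b where 1: "quotient_of x = (a, b)" by fastforce
  obtain c d where 2: "quotient_of y = (c, d)" by fastforce
  have "b > 0" "d > 0" using quotient_of_denom_pos 1 2 by blast+
  moreover have "x = of_int a / of_int b" "y = of_int c / of_int d" using quotient_of_div 1 2 by blast+
  ultimately show ?thesis by (intro that[of "b * d" "a * d" "c * b"]) auto
qed

lemma padic_abs_nonneg [simp]: "padic_abs p x \<ge> 0"
  by (simp add: padic_abs_def)

lemma padic_abs_eq_0_iff [simp]: "padic_abs p x = 0 \<longleftrightarrow> x = 0"
  using p by (auto simp: padic_abs_def prime_gt_0_nat)

lemma padic_abs_mult: "padic_abs p (x * y) = padic_abs p x * padic_abs p y"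
proof (cases "x = 0 \<or> y = 0")
  case False
  obtain a b c where h: "c \<noteq> 0" "x = of_int a / of_int c" "y = of_int b / of_int c"
    by (rule rat_frac_cases)
  have nz: "a \<noteq> 0" "b \<noteq> 0" using False h by auto
  have xy: "x * y = of_int (a * b) / of_int (c * c)" unfolding h by simp
  have pe: "prime_elem (int p)" using p by auto
  have "padic_val p (x * y) = int (multiplicity (int p) (a * b)) - int (multiplicity (int p) (c * c))"
    unfolding xy using h(1) nz by (intro padic_val_frac) auto
  moreover have "padic_val p x = int (multiplicity (int p) a) - int (multiplicity (int p) c)"
    unfolding h(2) using h(1) nz by (intro padic_val_frac)
  moreover have "padic_val p y = int (multiplicity (int p) b) - int (multiplicity (int p) c)"
    unfolding h(3) using h(1) nz by (intro padic_val_frac)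
  ultimately have "padic_val p (x * y) = padic_val p x + padic_val p y"
    using h(1) nz by (simp add: prime_elem_multiplicity_mult_distrib[OF pe])
  hence eq: "- padic_val p (x * y) = - padic_val p x + - padic_val p y" by simp
  have "real p \<noteq> 0" using p by (simp add: prime_gt_0_nat)
  hence "real p powi (- padic_val p (x * y)) = real p powi (- padic_val p x) * real p powi (- padic_val p y)"
    unfolding eq by (intro power_int_add) simp
  thus ?thesis using False by (simp add: padic_abs_def)
qed auto

lemma padic_abs_one [simp]: "padic_abs p 1 = 1"
  using padic_val_frac[of 1 1] by (simp add: padic_abs_def)

lemma padic_abs_self: "padic_abs p (of_nat p) = 1 / real p"
proof -
  have "padic_val p (of_int (int p) / of_int 1) = 1"
    using p by (subst padic_val_frac) auto
  thus ?thesis using p by (simp add: padic_abs_def power_int_minus field_simps)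
qed

lemma padic_abs_minus [simp]: "padic_abs p (- x) = padic_abs p x"
proof -
  have "padic_abs p (-1) * padic_abs p (-1) = 1" using padic_abs_mult[of "-1" "-1"] by simp
  hence "(padic_abs p (-1))\<^sup>2 = 1" by (simp only: power2_eq_square)
  hence "padic_abs p (-1) = 1" using padic_abs_nonneg[of "-1"] by (auto simp: power2_eq_1_iff)
  thus ?thesis using padic_abs_mult[of "-1" x] by simp
qed

lemma padic_abs_diff_commute: "padic_abs p (x - y) = padic_abs p (y - x)"
  using padic_abs_minus[of "x - y"] by simp

lemma padic_abs_inverse: "padic_abs p (inverse x) = inverse (padic_abs p x)"
proof (cases "x = 0")
  case False
  hence "padic_abs p x * padic_abs p (inverse x) = 1"
    using padic_abs_mult[of x "inverse x"] by simp
  thus ?thesis by (metis inverse_unique)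
qed auto

lemma padic_abs_ultrametric: "padic_abs p (x + y) \<le> max (padic_abs p x) (padic_abs p y)"
proof (cases "x = 0 \<or> y = 0 \<or> x + y = 0")
  case False
  obtain a b c where h: "c \<noteq> 0" "x = of_int a / of_int c" "y = of_int b / of_int c"
    by (rule rat_frac_cases)
  have xy: "x + y = of_int (a + b) / of_int c" using h by (simp add: add_divide_distrib)
  have nz: "a \<noteq> 0" "b \<noteq> 0" "a + b \<noteq> 0" using False h xy by auto
  let ?m = "multiplicity (int p)"
  have nu: "\<not> is_unit (int p)" using p by (metis not_prime_unit prime_int_nat_transfer nat_int of_nat_0_le_iff)
  have "int p ^ min (?m a) (?m b) dvd a + b"
    by (intro dvd_add multiplicity_dvd') auto
  hence "min (?m a) (?m b) \<le> ?m (a + b)"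
    using nz nu by (intro multiplicity_geI) auto
  hence "- padic_val p (x + y) \<le> max (- padic_val p x) (- padic_val p y)"
    unfolding xy unfolding h using h(1) nz by (simp add: padic_val_frac del: of_int_add)
  moreover have "real p \<ge> 1" using prime_ge_1_nat[OF p] by simp
  ultimately have "real p powi (- padic_val p (x + y)) \<le> max (real p powi (- padic_val p x)) (real p powi (- padic_val p y))"
    by (metis max_def power_int_increasing max.coboundedI1 max.coboundedI2)
  thus ?thesis using False by (simp add: padic_abs_def)
qed (auto simp: le_max_iff_disj)

lemma padic_abs_add_le: "padic_abs p (x + y) \<le> padic_abs p x + padic_abs p y"
  using padic_abs_ultrametric[of x y] padic_abs_nonneg[of x] padic_abs_nonneg[of y] by linarith

lemma padic_abs_diff_le: "\<bar>padic_abs p x - padic_abs p y\<bar> \<le> padic_abs p (x - y)"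
  using padic_abs_add_le[of "x - y" y] padic_abs_add_le[of "y - x" x] padic_abs_diff_commute[of x y]
  by auto

end


section \<open>The field of p-adic numbers as the completion of the rationals\<close>

definition padic_cauchy :: "nat \<Rightarrow> (nat \<Rightarrow> rat) \<Rightarrow> bool" where
  "padic_cauchy p X \<longleftrightarrow> (\<forall>e>0. \<exists>N. \<forall>m\<ge>N. \<forall>n\<ge>N. padic_abs p (X m - X n) < e)"

definition padic_null :: "nat \<Rightarrow> (nat \<Rightarrow> rat) \<Rightarrow> bool" where
  "padic_null p X \<longleftrightarrow> (\<lambda>n. padic_abs p (X n)) \<longlonglongrightarrow> 0"

context
  fixes p :: nat
  assumes p: "prime p"
begin

lemma padic_cauchy_iff: "padic_cauchy p X \<longleftrightarrow> padic_null p (\<lambda>n. X (Suc n) - X n)"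
proof
  assume "padic_cauchy p X"
  thus "padic_null p (\<lambda>n. X (Suc n) - X n)"
    unfolding padic_cauchy_def padic_null_def lim_sequentially dist_real_def
    using padic_abs_nonneg[OF p] by (metis abs_of_nonneg diff_zero le_SucI)
next
  assume L: "padic_null p (\<lambda>n. X (Suc n) - X n)"
  show "padic_cauchy p X"
    unfolding padic_cauchy_def
  proof (intro allI impI)
    fix e :: real assume e: "e > 0"
    then obtain N where N: "\<And>n. n \<ge> N \<Longrightarrow> padic_abs p (X (Suc n) - X n) < e"
      using L unfolding padic_null_def lim_sequentially by (auto simp: padic_abs_nonneg[OF p])
    have *: "padic_abs p (X m - X N) < e" if "m \<ge> N" for m
      using that
    proof (induction m rule: dec_induct)
      case (step m)
      have "padic_abs p (X (Suc m) - X N) \<le> max (padic_abs p (X (Suc m) - X m)) (padic_abs p (X m - X N))"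
        using padic_abs_ultrametric[OF p, of "X (Suc m) - X m" "X m - X N"] by simp
      thus ?case using N[of m] step by auto
    qed (use e in simp)
    have "padic_abs p (X m - X n) < e" if "m \<ge> N" "n \<ge> N" for m n
    proof -
      have "padic_abs p (X m - X n) \<le> max (padic_abs p (X m - X N)) (padic_abs p (X N - X n))"
        using padic_abs_ultrametric[OF p, of "X m - X N" "X N - X n"] by simp
      thus ?thesis using *[OF that(1)] *[OF that(2)] padic_abs_diff_commute[OF p, of "X N"] by auto
    qed
    thus "\<exists>N. \<forall>m\<ge>N. \<forall>n\<ge>N. padic_abs p (X m - X n) < e" by blast
  qed
qed

lemma padic_null_le:
  assumes "\<And>n. padic_abs p (X n) \<le> f n" "f \<longlonglongrightarrow> 0"
  shows "padic_null p X"
  unfolding padic_null_def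
  by (rule tendsto_sandwich[OF _ _ tendsto_const assms(2)]) (use assms(1) padic_abs_nonneg[OF p] in auto)

lemma padic_null_add: "padic_null p X \<Longrightarrow> padic_null p Y \<Longrightarrow> padic_null p (\<lambda>n. X n + Y n)"
  using padic_abs_add_le[OF p]
  by (intro padic_null_le[where f = "\<lambda>n. padic_abs p (X n) + padic_abs p (Y n)"])
     (auto simp: padic_null_def intro: tendsto_add_zero)

lemma padic_null_minus: "padic_null p (\<lambda>n. - X n) \<longleftrightarrow> padic_null p X"
  by (simp add: padic_null_def padic_abs_minus[OF p])

lemma padic_null_diff: "padic_null p X \<Longrightarrow> padic_null p Y \<Longrightarrow> padic_null p (\<lambda>n. X n - Y n)"
  using padic_null_add[of X "\<lambda>n. - Y n"] padic_null_minus[of Y] by simp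

lemma padic_null_diff_commute: "padic_null p (\<lambda>n. X n - Y n) \<longleftrightarrow> padic_null p (\<lambda>n. Y n - X n)"
  using padic_null_minus[of "\<lambda>n. X n - Y n"] by simp

lemma padic_null_zero: "padic_null p (\<lambda>n. 0)"
  by (simp add: padic_null_def)

lemma padic_cauchy_convergent:
  assumes "padic_cauchy p X"
  shows "convergent (\<lambda>n. padic_abs p (X n))"
proof -
  have "Cauchy (\<lambda>n. padic_abs p (X n))"
    unfolding Cauchy_def dist_real_def
    using assms padic_abs_diff_le[OF p] unfolding padic_cauchy_def by (meson le_less_trans)
  thus ?thesis by (simp add: Cauchy_convergent_iff)
qed

lemma padic_null_mult:
  assumes "padic_cauchy p X" "padic_null p Y"
  shows "padic_null p (\<lambda>n. X n * Y n)"
proof -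
  obtain L where "(\<lambda>n. padic_abs p (X n)) \<longlonglongrightarrow> L"
    using padic_cauchy_convergent[OF assms(1)] by (auto simp: convergent_def)
  from tendsto_mult[OF this assms(2)[unfolded padic_null_def]]
  show ?thesis by (simp add: padic_null_def padic_abs_mult[OF p])
qed

lemma padic_cauchy_Suc: "padic_cauchy p X \<Longrightarrow> padic_cauchy p (\<lambda>n. X (Suc n))"
  unfolding padic_cauchy_def by (meson le_SucI)

lemma padic_cauchy_const: "padic_cauchy p (\<lambda>n. c)"
  by (simp add: padic_cauchy_def)

lemma padic_cauchy_add:
  "padic_cauchy p X \<Longrightarrow> padic_cauchy p Y \<Longrightarrow> padic_cauchy p (\<lambda>n. X n + Y n)"
  unfolding padic_cauchy_iff by (drule (1) padic_null_add) (simp add: algebra_simps)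

lemma padic_cauchy_minus: "padic_cauchy p X \<Longrightarrow> padic_cauchy p (\<lambda>n. - X n)"
  unfolding padic_cauchy_iff by (subst padic_null_minus[symmetric]) (simp add: algebra_simps)

lemma padic_cauchy_mult:
  assumes "padic_cauchy p X" "padic_cauchy p Y"
  shows "padic_cauchy p (\<lambda>n. X n * Y n)"
proof -
  have "padic_null p (\<lambda>n. X (Suc n) * (Y (Suc n) - Y n) + Y n * (X (Suc n) - X n))"
    using assms by (intro padic_null_add padic_null_mult padic_cauchy_Suc) (simp_all add: padic_cauchy_iff)
  thus ?thesis unfolding padic_cauchy_iff by (simp add: algebra_simps)
qed

lemma padic_cauchy_not_null:
  assumes "padic_cauchy p X" "\<not> padic_null p X"
  obtains L where "L > 0" "(\<lambda>n. padic_abs p (X n)) \<longlonglongrightarrow> L" "eventually (\<lambda>n. X n \<noteq> 0) sequentially"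
proof -
  obtain L where L: "(\<lambda>n. padic_abs p (X n)) \<longlonglongrightarrow> L"
    using padic_cauchy_convergent[OF assms(1)] by (auto simp: convergent_def)
  have "L \<ge> 0" by (rule LIMSEQ_le_const[OF L]) (auto simp: padic_abs_nonneg[OF p])
  moreover have "L \<noteq> 0" using assms(2) L by (auto simp: padic_null_def)
  ultimately have pos: "L > 0" by simp
  have "eventually (\<lambda>n. X n \<noteq> 0) sequentially"
    using order_tendstoD(1)[OF L pos] by eventually_elim auto
  with pos L show ?thesis using that by blast
qed

lemma padic_null_inverse_diff:
  assumes "padic_cauchy p X" "\<not> padic_null p X" "padic_cauchy p Y" "\<not> padic_null p Y"
    and "padic_null p (\<lambda>n. X n - Y n)"
  shows "padic_null p (\<lambda>n. inverse (X n) - inverse (Y n))"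
proof -
  obtain L where L: "L > 0" "(\<lambda>n. padic_abs p (X n)) \<longlonglongrightarrow> L" "eventually (\<lambda>n. X n \<noteq> 0) sequentially"
    using padic_cauchy_not_null assms by metis
  obtain M where M: "M > 0" "(\<lambda>n. padic_abs p (Y n)) \<longlonglongrightarrow> M" "eventually (\<lambda>n. Y n \<noteq> 0) sequentially"
    using padic_cauchy_not_null assms by metis
  have "(\<lambda>n. inverse (padic_abs p (X n)) * padic_abs p (X n - Y n) * inverse (padic_abs p (Y n)))
          \<longlonglongrightarrow> inverse L * 0 * inverse M"
    using L M assms(5) by (intro tendsto_intros) (auto simp: padic_null_def)
  moreover have "eventually (\<lambda>n. inverse (padic_abs p (X n)) * padic_abs p (X n - Y n) * inverse (padic_abs p (Y n))
        = padic_abs p (inverse (X n) - inverse (Y n))) sequentially"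
    using L(3) M(3)
    by eventually_elim
       (simp add: inverse_diff_inverse padic_abs_mult[OF p] padic_abs_inverse[OF p] padic_abs_minus[OF p])
  ultimately show ?thesis unfolding padic_null_def by (simp add: tendsto_cong)
qed

lemma padic_null_Suc: "padic_null p (\<lambda>n. X (Suc n)) \<longleftrightarrow> padic_null p X"
  unfolding padic_null_def by (rule filterlim_sequentially_Suc)

lemma padic_cauchy_inverse:
  assumes "padic_cauchy p X" "\<not> padic_null p X"
  shows "padic_cauchy p (\<lambda>n. inverse (X n))"
  unfolding padic_cauchy_iff using assms padic_cauchy_Suc padic_null_Suc[of X]
  by (intro padic_null_inverse_diff) (auto simp: padic_cauchy_iff)

lemma padic_null_cong: 
  assumes "padic_null p (\<lambda>n. X n - Y n)"
  shows "padic_null p X \<longleftrightarrow> padic_null p Y"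
  using padic_null_diff[OF _ assms, of X] padic_null_add[OF assms, of Y] by auto

lemma padic_abs_lim_eq:
  assumes "padic_cauchy p X" "padic_null p (\<lambda>n. X n - Y n)"
  shows "lim (\<lambda>n. padic_abs p (X n)) = lim (\<lambda>n. padic_abs p (Y n))"
proof -
  obtain L where L: "(\<lambda>n. padic_abs p (X n)) \<longlonglongrightarrow> L"
    using padic_cauchy_convergent[OF assms(1)] by (auto simp: convergent_def)
  have "(\<lambda>n. padic_abs p (X n) - padic_abs p (Y n)) \<longlonglongrightarrow> 0"
    by (rule Lim_null_comparison[OF _ assms(2)[unfolded padic_null_def]])
       (auto simp: padic_abs_diff_le[OF p])
  from tendsto_diff[OF L this] have "(\<lambda>n. padic_abs p (Y n)) \<longlonglongrightarrow> L" by simp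
  with L show ?thesis by (simp add: limI)
qed

end


text \<open>
  The prime is a type parameter: \<open>'p padic\<close> is the field of $p$-adic numbers for $p$ the cardinality
  of \<open>'p\<close>, which the class \<open>prime_card\<close> makes prime.  Its elements are the Cauchy sequences of
  rationals with respect to the $p$-adic absolute value, modulo null sequences.
\<close>

typedef (overloaded) 'p padic_seq = "{X. padic_cauchy CARD('p::prime_card) X}"
  morphisms seq_of Abs_padic_seq
  by (auto intro!: exI[of _ "\<lambda>_. 0"] simp: padic_cauchy_const[OF prime_card])

setup_lifting type_definition_padic_seq

lemma padic_cauchy_seq_of [simp]: "padic_cauchy CARD('p) (seq_of (X :: 'p::prime_card padic_seq))"
  using seq_of[of X] by simp

definition padic_eq :: "'p::prime_card padic_seq \<Rightarrow> 'p padic_seq \<Rightarrow> bool" where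
  "padic_eq X Y \<longleftrightarrow> padic_null CARD('p) (\<lambda>n. seq_of X n - seq_of Y n)"

lemma equivp_padic_eq: "equivp (padic_eq :: 'p::prime_card padic_seq \<Rightarrow> _)"
proof (rule equivpI)
  note p = prime_card[where ?'a = 'p]
  show "reflp (padic_eq :: 'p padic_seq \<Rightarrow> _)"
    by (auto simp: reflp_def padic_eq_def padic_null_zero[OF p])
  show "symp (padic_eq :: 'p padic_seq \<Rightarrow> _)"
    unfolding symp_def padic_eq_def using padic_null_diff_commute[OF p] by blast
  show "transp (padic_eq :: 'p padic_seq \<Rightarrow> _)"
  proof (rule transpI)
    fix X Y Z :: "'p padic_seq" assume "padic_eq X Y" "padic_eq Y Z"
    thus "padic_eq X Z"
      using padic_null_add[OF p, of "\<lambda>n. seq_of X n - seq_of Y n" "\<lambda>n. seq_of Y n - seq_of Z n"]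
      by (auto simp: padic_eq_def)
  qed
qed

quotient_type (overloaded) 'p padic = "'p::prime_card padic_seq" / padic_eq
  by (rule equivp_padic_eq)

lift_definition seq_const :: "rat \<Rightarrow> 'p::prime_card padic_seq" is "\<lambda>c n. c"
  by (rule padic_cauchy_const[OF prime_card])

lift_definition seq_add :: "'p::prime_card padic_seq \<Rightarrow> 'p padic_seq \<Rightarrow> 'p padic_seq"
  is "\<lambda>X Y n. X n + Y n"
  by (rule padic_cauchy_add[OF prime_card])

lift_definition seq_minus :: "'p::prime_card padic_seq \<Rightarrow> 'p padic_seq" is "\<lambda>X n. - X n"
  by (rule padic_cauchy_minus[OF prime_card])

lift_definition seq_mult :: "'p::prime_card padic_seq \<Rightarrow> 'p padic_seq \<Rightarrow> 'p padic_seq"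
  is "\<lambda>X Y n. X n * Y n"
  by (rule padic_cauchy_mult[OF prime_card])

lift_definition seq_inverse :: "'p::prime_card padic_seq \<Rightarrow> 'p padic_seq"
  is "\<lambda>X. if padic_null CARD('p) X then (\<lambda>n. 0) else (\<lambda>n. inverse (X n))"
  by (auto simp: padic_cauchy_const[OF prime_card] padic_cauchy_inverse[OF prime_card])

instantiation padic :: (prime_card) field
begin

lift_definition zero_padic :: "'a padic" is "seq_const 0" .

lift_definition one_padic :: "'a padic" is "seq_const 1" .

lift_definition plus_padic :: "'a padic \<Rightarrow> 'a padic \<Rightarrow> 'a padic" is seq_add
  unfolding padic_eq_def seq_add.rep_eq
  by (drule (1) padic_null_add[OF prime_card]) (simp add: algebra_simps)

lift_definition uminus_padic :: "'a padic \<Rightarrow> 'a padic" is seq_minus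
  unfolding padic_eq_def seq_minus.rep_eq
  by (subst (asm) padic_null_diff_commute[OF prime_card]) simp

lift_definition times_padic :: "'a padic \<Rightarrow> 'a padic \<Rightarrow> 'a padic" is seq_mult
proof -
  fix X X' Y Y' :: "'a padic_seq"
  note p = prime_card[where ?'a = 'a]
  assume "padic_eq X X'" "padic_eq Y Y'"
  hence "padic_null CARD('a) (\<lambda>n. seq_of X n * (seq_of Y n - seq_of Y' n) + seq_of Y' n * (seq_of X n - seq_of X' n))"
    by (intro padic_null_add[OF p] padic_null_mult[OF p]) (simp_all add: padic_eq_def)
  thus "padic_eq (seq_mult X Y) (seq_mult X' Y')"
    by (simp add: padic_eq_def seq_mult.rep_eq algebra_simps)
qed

lift_definition inverse_padic :: "'a padic \<Rightarrow> 'a padic" is seq_inverse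
proof -
  fix X Y :: "'a padic_seq"
  note p = prime_card[where ?'a = 'a]
  assume "padic_eq X Y"
  thus "padic_eq (seq_inverse X) (seq_inverse Y)"
    using padic_null_cong[OF p, of "seq_of X" "seq_of Y"]
    by (auto simp: padic_eq_def seq_inverse.rep_eq padic_null_zero[OF p] intro: padic_null_inverse_diff[OF p])
qed

definition minus_padic :: "'a padic \<Rightarrow> 'a padic \<Rightarrow> 'a padic" where
  "minus_padic x y = x + - y"

definition divide_padic :: "'a padic \<Rightarrow> 'a padic \<Rightarrow> 'a padic" where
  "divide_padic x y = x * inverse y"

instance
proof
  note p = prime_card[where ?'a = 'a]
  note [simp] = padic_eq_def padic_null_zero[OF p] seq_const.rep_eq seq_add.rep_eq seq_minus.rep_eq
    seq_mult.rep_eq seq_inverse.rep_eq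
  fix a b c :: "'a padic"
  show "a + b + c = a + (b + c)" by transfer (simp add: algebra_simps)
  show "a + b = b + a" by transfer (simp add: algebra_simps)
  show "0 + a = a" by transfer simp
  show "- a + a = 0" by transfer simp
  show "a - b = a + - b" by (simp add: minus_padic_def)
  show "a * b * c = a * (b * c)" by transfer (simp add: algebra_simps)
  show "a * b = b * a" by transfer (simp add: algebra_simps)
  show "1 * a = a" by transfer simp
  show "(a + b) * c = a * c + b * c" by transfer (simp add: algebra_simps)
  show "(0 :: 'a padic) \<noteq> 1"
    by transfer (simp add: padic_null_def padic_abs_minus[OF p] padic_abs_one[OF p] LIMSEQ_const_iff)
  show "inverse a * a = 1" if "a \<noteq> 0"
    using that
  proof transfer
    fix X :: "'a padic_seq"
    assume "\<not> padic_eq X (seq_const 0)"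
    hence nn: "\<not> padic_null CARD('a) (seq_of X)" by simp
    obtain L where "eventually (\<lambda>n. seq_of X n \<noteq> 0) sequentially"
      using padic_cauchy_not_null[OF p padic_cauchy_seq_of nn] by metis
    hence "eventually (\<lambda>n. padic_abs CARD('a) (inverse (seq_of X n) * seq_of X n - 1) = 0) sequentially"
      by eventually_elim simp
    thus "padic_eq (seq_mult (seq_inverse X) X) (seq_const 1)"
      using nn by (simp add: padic_null_def tendsto_eventually)
  qed
  show "a div b = a * inverse b" by (simp add: divide_padic_def)
  show "inverse (0 :: 'a padic) = 0" by transfer simp
qed

end

lift_definition padic_norm :: "'p::prime_card padic \<Rightarrow> real"
  is "\<lambda>X. lim (\<lambda>n. padic_abs CARD('p) (seq_of X n))"
  unfolding padic_eq_def by (rule padic_abs_lim_eq[OF prime_card padic_cauchy_seq_of])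

lemma padic_seq_abs_tendsto:
  fixes X :: "'p::prime_card padic_seq"
  shows "(\<lambda>n. padic_abs CARD('p) (seq_of X n)) \<longlonglongrightarrow> lim (\<lambda>n. padic_abs CARD('p) (seq_of X n))"
  using padic_cauchy_convergent[OF prime_card padic_cauchy_seq_of] by (simp add: convergent_LIMSEQ_iff)

lemma padic_norm_nonneg [simp]: "padic_norm (x :: 'p::prime_card padic) \<ge> 0"
  by transfer (rule LIMSEQ_le_const[OF padic_seq_abs_tendsto], simp add: padic_abs_nonneg[OF prime_card])

lemma padic_norm_eq_0_iff [simp]: "padic_norm (x :: 'p::prime_card padic) = 0 \<longleftrightarrow> x = 0"
proof transfer
  fix X :: "'p padic_seq"
  show "lim (\<lambda>n. padic_abs CARD('p) (seq_of X n)) = 0 \<longleftrightarrow> padic_eq X (seq_const 0)"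
    using padic_seq_abs_tendsto[of X] by (auto simp: padic_eq_def padic_null_def seq_const.rep_eq intro: limI)
qed

lemma padic_norm_mult: "padic_norm (x * y :: 'p::prime_card padic) = padic_norm x * padic_norm y"
proof transfer
  fix X Y :: "'p padic_seq"
  show "lim (\<lambda>n. padic_abs CARD('p) (seq_of (seq_mult X Y) n)) =
    lim (\<lambda>n. padic_abs CARD('p) (seq_of X n)) * lim (\<lambda>n. padic_abs CARD('p) (seq_of Y n))"
    using tendsto_mult[OF padic_seq_abs_tendsto[of X] padic_seq_abs_tendsto[of Y]]
    by (intro limI) (simp add: seq_mult.rep_eq padic_abs_mult[OF prime_card])
qed

lemma padic_norm_ultrametric: "padic_norm (x + y :: 'p::prime_card padic) \<le> max (padic_norm x) (padic_norm y)"
proof transfer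
  fix X Y :: "'p padic_seq"
  show "lim (\<lambda>n. padic_abs CARD('p) (seq_of (seq_add X Y) n)) \<le>
    max (lim (\<lambda>n. padic_abs CARD('p) (seq_of X n))) (lim (\<lambda>n. padic_abs CARD('p) (seq_of Y n)))"
    using padic_abs_ultrametric[OF prime_card]
    by (intro LIMSEQ_le[OF padic_seq_abs_tendsto tendsto_max[OF padic_seq_abs_tendsto padic_seq_abs_tendsto]])
       (auto simp: seq_add.rep_eq)
qed

lift_definition padic_of_rat :: "rat \<Rightarrow> 'p::prime_card padic" is seq_const .

lemma padic_norm_of_rat: "padic_norm (padic_of_rat r :: 'p::prime_card padic) = padic_abs CARD('p) r"
  by transfer (simp add: seq_const.rep_eq)

lemma padic_of_rat_of_nat: "padic_of_rat (of_nat n) = (of_nat n :: 'p::prime_card padic)"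
proof (induction n)
  case 0
  show ?case by (simp, transfer) (simp add: padic_eq_def padic_null_zero[OF prime_card])
next
  case (Suc n)
  have "padic_of_rat (a + 1) = padic_of_rat a + (1 :: 'p padic)" for a
    by transfer (simp add: padic_eq_def seq_const.rep_eq seq_add.rep_eq padic_null_zero[OF prime_card])
  from this[of "of_nat n"] Suc show ?case by (simp add: add.commute)
qed

lemma padic_norm_of_nat: "padic_norm (of_nat n :: 'p::prime_card padic) = padic_abs CARD('p) (of_nat n)"
  by (simp flip: padic_of_rat_of_nat add: padic_norm_of_rat)

lemma padic_norm_self: "padic_norm (of_nat CARD('p) :: 'p::prime_card padic) = 1 / real CARD('p)"
  by (simp add: padic_norm_of_nat padic_abs_self[OF prime_card])

instance padic :: (prime_card) field_char_0
proof (intro_classes, rule injI)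
  fix m n :: nat
  assume eq: "(of_nat m :: 'a padic) = of_nat n"
  have "m = n" if "(of_nat m :: 'a padic) = of_nat n" "m \<le> n" for m n
  proof -
    have "(of_nat (n - m) :: 'a padic) = 0" using that by (simp add: of_nat_diff)
    hence "padic_abs CARD('a) (of_nat (n - m)) = 0" by (simp flip: padic_norm_of_nat)
    thus ?thesis using that(2) by (simp add: padic_abs_eq_0_iff[OF prime_card])
  qed
  from this[of m n] this[of n m] eq show "m = n" by (metis nat_le_linear)
qed


text \<open>
  The metric of the absolute value is complete and the rationals are dense in it, so
  \<open>'p padic\<close> is indeed the completion of the rationals.
\<close>

lemma padic_norm_zero [simp]: "padic_norm (0 :: 'p::prime_card padic) = 0"
  by simp

lemma padic_norm_one [simp]: "padic_norm (1 :: 'p::prime_card padic) = 1"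
  using padic_norm_of_nat[of 1, where ?'p = 'p] by (simp add: padic_abs_one[OF prime_card])

lemma padic_norm_minus [simp]: "padic_norm (- x :: 'p::prime_card padic) = padic_norm x"
  by transfer (simp add: seq_minus.rep_eq padic_abs_minus[OF prime_card])

lemma padic_norm_diff_ultrametric:
  "padic_norm (x - y :: 'p::prime_card padic) \<le> max (padic_norm x) (padic_norm y)"
  using padic_norm_ultrametric[of x "- y"] by simp

lemma padic_of_rat_eq_of_rat: "padic_of_rat r = (of_rat r :: 'p::prime_card padic)"
proof -
  note p = prime_card[where ?'a = 'p]
  have mult: "padic_of_rat (x * y) = padic_of_rat x * (padic_of_rat y :: 'p padic)" for x y
    by transfer (simp add: padic_eq_def seq_const.rep_eq seq_mult.rep_eq padic_null_zero[OF p])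
  have minus: "padic_of_rat (- x) = - (padic_of_rat x :: 'p padic)" for x
    by transfer (simp add: padic_eq_def seq_const.rep_eq seq_minus.rep_eq padic_null_zero[OF p])
  have int: "padic_of_rat (of_int k) = (of_int k :: 'p padic)" for k
    by (cases k rule: int_cases2) (simp_all add: minus padic_of_rat_of_nat)
  obtain a b where ab: "quotient_of r = (a, b)" by fastforce
  have b: "b > 0" and r: "r = of_int a / of_int b" using quotient_of_denom_pos quotient_of_div ab by blast+
  have "padic_of_rat r * of_int b = (of_int a :: 'p padic)"
    using mult[of r "of_int b"] b by (simp add: int r)
  thus ?thesis using b by (simp add: r of_rat_divide field_simps)
qed

instantiation padic :: (prime_card) metric_space
begin

definition dist_padic :: "'a padic \<Rightarrow> 'a padic \<Rightarrow> real" where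
  "dist_padic x y = padic_norm (x - y)"

definition uniformity_padic :: "('a padic \<times> 'a padic) filter" where
  "uniformity_padic = (INF e\<in>{0 <..}. principal {(x, y). dist x y < e})"

definition open_padic :: "'a padic set \<Rightarrow> bool" where
  "open_padic U \<longleftrightarrow> (\<forall>x\<in>U. \<forall>\<^sub>F (x', y) in uniformity. x' = x \<longrightarrow> y \<in> U)"

instance
proof
  fix x y z :: "'a padic"
  show "dist x y = 0 \<longleftrightarrow> x = y" by (simp add: dist_padic_def)
  have "padic_norm (x - y) \<le> max (padic_norm (x - z)) (padic_norm (y - z))"
    using padic_norm_diff_ultrametric[of "x - z" "y - z"] by simp
  thus "dist x y \<le> dist x z + dist y z"
    unfolding dist_padic_def
    using padic_norm_nonneg[of "x - z"] padic_norm_nonneg[of "y - z"] by linarith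
qed (simp_all add: uniformity_padic_def open_padic_def)

end

lemma padic_seq_tendsto:
  fixes X :: "'p::prime_card padic_seq"
  shows "(\<lambda>n. of_rat (seq_of X n)) \<longlonglongrightarrow> abs_padic X"
proof (rule metric_LIMSEQ_I)
  fix e :: real assume e: "e > 0"
  note p = prime_card[where ?'a = 'p]
  have norm_eq: "padic_norm (padic_of_rat r - abs_padic X) = lim (\<lambda>n. padic_abs CARD('p) (r - seq_of X n))" for r
    by (simp add: minus_padic_def padic_of_rat.abs_eq uminus_padic.abs_eq plus_padic.abs_eq
        padic_norm.abs_eq seq_add.rep_eq seq_minus.rep_eq seq_const.rep_eq)
  from e obtain N where N: "\<And>m n. m \<ge> N \<Longrightarrow> n \<ge> N \<Longrightarrow> padic_abs CARD('p) (seq_of X m - seq_of X n) < e / 2"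
    using padic_cauchy_seq_of[of X] unfolding padic_cauchy_def by (meson half_gt_zero)
  have "dist (of_rat (seq_of X m)) (abs_padic X) < e" if "m \<ge> N" for m
  proof -
    have "padic_cauchy CARD('p) (\<lambda>n. seq_of X m - seq_of X n)"
      using padic_cauchy_add[OF p padic_cauchy_const[OF p] padic_cauchy_minus[OF p padic_cauchy_seq_of[of X]]]
      by simp
    from padic_cauchy_convergent[OF p this]
    have "lim (\<lambda>n. padic_abs CARD('p) (seq_of X m - seq_of X n)) \<le> e / 2"
      unfolding convergent_LIMSEQ_iff
      by (rule LIMSEQ_le_const2) (use N[OF that] in \<open>auto intro!: exI[of _ N] less_imp_le\<close>)
    thus ?thesis using e by (simp add: dist_padic_def norm_eq flip: padic_of_rat_eq_of_rat)
  qed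
  thus "\<exists>N. \<forall>n\<ge>N. dist (of_rat (seq_of X n)) (abs_padic X) < e" by blast
qed

lemma padic_rat_dense:
  fixes x :: "'p::prime_card padic"
  assumes "e > 0"
  shows "\<exists>r. dist x (of_rat r) < e"
proof -
  have "\<exists>X. x = abs_padic X" by (induction x rule: padic.abs_induct) blast
  then obtain X where X: "x = abs_padic X" by blast
  show ?thesis
    using metric_LIMSEQ_D[OF padic_seq_tendsto[of X] assms] unfolding X by (metis dist_commute order_refl)
qed

instance padic :: (prime_card) complete_space
proof
  fix x :: "nat \<Rightarrow> 'a padic" assume x: "Cauchy x"
  have "\<exists>r. \<forall>n. dist (x n) (of_rat (r n)) < inverse (real (Suc n))"
    by (intro choice allI padic_rat_dense) simp
  then obtain r where r: "\<And>n. dist (x n) (of_rat (r n)) < inverse (real (Suc n))" by blast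
  have close: "(\<lambda>n. dist (x n) (of_rat (r n))) \<longlonglongrightarrow> 0"
    by (rule tendsto_sandwich[OF _ _ tendsto_const LIMSEQ_inverse_real_of_nat])
       (use r[THEN less_imp_le] in \<open>auto simp del: of_nat_Suc\<close>)
  have "padic_cauchy CARD('a) r"
    unfolding padic_cauchy_def
  proof (intro allI impI)
    fix e :: real assume "e > 0"
    hence e3: "e / 3 > 0" by simp
    obtain N1 where N1: "\<And>n. n \<ge> N1 \<Longrightarrow> dist (x n) (of_rat (r n)) < e / 3"
      using order_tendstoD(2)[OF close e3] by (auto simp: eventually_sequentially)
    obtain N2 where N2: "\<And>m n. m \<ge> N2 \<Longrightarrow> n \<ge> N2 \<Longrightarrow> dist (x m) (x n) < e / 3"
      using metric_CauchyD[OF x e3] by blast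
    have "padic_abs CARD('a) (r m - r n) < e" if "m \<ge> max N1 N2" "n \<ge> max N1 N2" for m n
    proof -
      have "padic_abs CARD('a) (r m - r n) = dist (of_rat (r m) :: 'a padic) (of_rat (r n))"
        unfolding dist_padic_def of_rat_diff[symmetric]
        unfolding padic_of_rat_eq_of_rat[symmetric] padic_norm_of_rat ..
      also have "\<dots> \<le> dist (x m) (of_rat (r m)) + dist (x m) (x n) + dist (x n) (of_rat (r n))"
        by (smt (verit) dist_triangle dist_commute)
      finally show ?thesis using N1[of m] N1[of n] N2[of m n] that by auto
    qed
    thus "\<exists>N. \<forall>m\<ge>N. \<forall>n\<ge>N. padic_abs CARD('a) (r m - r n) < e" by blast
  qed
  define L :: "'a padic" where "L = abs_padic (Abs_padic_seq r)"
  have "(\<lambda>n. of_rat (r n)) \<longlonglongrightarrow> L"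
    using padic_seq_tendsto[of "Abs_padic_seq r :: 'a padic_seq"] \<open>padic_cauchy CARD('a) r\<close>
    by (simp add: Abs_padic_seq_inverse L_def)
  hence "(\<lambda>n. dist (of_rat (r n)) L) \<longlonglongrightarrow> 0"
    by (rule tendsto_dist_iff[THEN iffD1])
  from tendsto_add_zero[OF close this]
  have lim: "(\<lambda>n. dist (x n) (of_rat (r n)) + dist (of_rat (r n)) L) \<longlonglongrightarrow> 0" .
  have "(\<lambda>n. dist (x n) L) \<longlonglongrightarrow> 0"
    by (rule tendsto_sandwich[OF _ _ tendsto_const lim]) (auto intro!: always_eventually dist_triangle)
  hence "x \<longlonglongrightarrow> L"
    by (rule tendsto_dist_iff[THEN iffD2])
  thus "convergent x" by (auto simp: convergent_def)
qed


section \<open>The semi-infinite Cayley tree of order three\<close>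

text \<open>
  A vertex is the list of choices made on the way from the root, the last choice first, so the
  direct successors of \<open>x\<close> are the three lists \<open>i # x\<close>, the root is \<open>[]\<close>, and the length of a list is
  the distance of the vertex from the root.  All lists occur, so \<open>V\<close> is \<open>UNIV\<close>.
\<close>

type_synonym vertex = "3 list"

abbreviation tree_root :: vertex where "tree_root \<equiv> []"

definition tree_W :: "nat \<Rightarrow> vertex set" where
  "tree_W n = {x. length x = n}"

definition tree_V :: "nat \<Rightarrow> vertex set" where
  "tree_V n = (\<Union>m\<in>{0..n}. tree_W m)"

text \<open>Each edge is recorded once, as the pair of a vertex and one of its direct successors.\<close>

definition tree_L :: "nat \<Rightarrow> (vertex \<times> vertex) set" where
  "tree_L n = {(x, y). x \<in> tree_V n \<and> y \<in> tree_V n \<and> (\<exists>i. y = i # x)}"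


section \<open>The Potts model\<close>

definition configs :: "nat \<Rightarrow> vertex set \<Rightarrow> (vertex \<Rightarrow> nat) set" where
  "configs q S = S \<rightarrow>\<^sub>E {0..<q}"

definition hamiltonian :: "nat \<Rightarrow> (vertex \<Rightarrow> nat) \<Rightarrow> nat" where
  "hamiltonian n \<sigma> = (\<Sum>(x, y)\<in>tree_L n. if \<sigma> x = \<sigma> y then 1 else 0)"

text \<open>
  The boundary function is curried, \<open>h x i\<close> standing for $h_{i,x}$.  Its values at the root and
  at \<open>i \<ge> q\<close> are never used.
\<close>

definition gibbs_weight ::
    "'a::field \<Rightarrow> (vertex \<Rightarrow> nat \<Rightarrow> 'a) \<Rightarrow> nat \<Rightarrow> (vertex \<Rightarrow> nat) \<Rightarrow> 'a" where
  "gibbs_weight \<rho> h n \<sigma> = \<rho> ^ hamiltonian n \<sigma> * (\<Prod>x\<in>tree_W n. h x (\<sigma> x))"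

definition partition_function ::
    "nat \<Rightarrow> 'a::field \<Rightarrow> (vertex \<Rightarrow> nat \<Rightarrow> 'a) \<Rightarrow> nat \<Rightarrow> 'a" where
  "partition_function q \<rho> h n = (\<Sum>\<sigma>\<in>configs q (tree_V n). gibbs_weight \<rho> h n \<sigma>)"

definition gibbs_dist ::
    "nat \<Rightarrow> 'a::field \<Rightarrow> (vertex \<Rightarrow> nat \<Rightarrow> 'a) \<Rightarrow> nat \<Rightarrow> (vertex \<Rightarrow> nat) \<Rightarrow> 'a" where
  "gibbs_dist q \<rho> h n \<sigma> = 1 / partition_function q \<rho> h n * gibbs_weight \<rho> h n \<sigma>"

text \<open>\<^term>\<open>merge I J (\<sigma>, \<omega>)\<close> is the concatenation of configurations on disjoint \<open>I\<close> and \<open>J\<close>.\<close>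

definition compatible :: "nat \<Rightarrow> 'a::field \<Rightarrow> (vertex \<Rightarrow> nat \<Rightarrow> 'a) \<Rightarrow> bool" where
  "compatible q \<rho> h \<longleftrightarrow>
     (\<forall>n\<ge>2. \<forall>\<sigma>\<in>configs q (tree_V (n - 1)).
        (\<Sum>\<omega>\<in>configs q (tree_W n). gibbs_dist q \<rho> h n (merge (tree_V (n - 1)) (tree_W n) (\<sigma>, \<omega>)))
          = gibbs_dist q \<rho> h (n - 1) \<sigma>)"


section \<open>Generalized p-adic quasi Gibbs measures\<close>

definition cylinder_sets :: "nat \<Rightarrow> (vertex \<Rightarrow> nat) set set" where
  "cylinder_sets q =
     {{\<sigma> \<in> configs q UNIV. restrict \<sigma> (tree_V n) \<in> B} | n B. B \<subseteq> configs q (tree_V n)}"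

definition padic_probability_measure ::
    "'b set \<Rightarrow> 'b set set \<Rightarrow> ('b set \<Rightarrow> 'p::prime_card padic) \<Rightarrow> bool" where
  "padic_probability_measure \<Omega> \<A> \<mu> \<longleftrightarrow> Sigma_Algebra.algebra \<Omega> \<A> \<and> Measure_Space.additive \<A> \<mu> \<and> \<mu> \<Omega> = 1"

text \<open>
  As division by zero yields zero in HOL, the partition functions have to be required nonzero for
  the finite-volume distributions to be the ones written in the formula.
\<close>

definition quasi_gibbs_measure ::
    "nat \<Rightarrow> 'p::prime_card padic \<Rightarrow> (vertex \<Rightarrow> nat \<Rightarrow> 'p padic) \<Rightarrow>
       ((vertex \<Rightarrow> nat) set \<Rightarrow> 'p padic) \<Rightarrow> bool" where
  "quasi_gibbs_measure q \<rho> h \<mu> \<longleftrightarrow>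
     (\<forall>x. x \<noteq> tree_root \<longrightarrow> h x 0 = 1) \<and>
     (\<forall>n\<ge>1. partition_function q \<rho> h n \<noteq> 0) \<and>
     compatible q \<rho> h \<and>
     padic_probability_measure (configs q UNIV) (cylinder_sets q) \<mu> \<and>
     (\<forall>n\<ge>1. \<forall>\<sigma>\<^sub>n\<in>configs q (tree_V n).
        \<mu> {\<sigma> \<in> configs q UNIV. restrict \<sigma> (tree_V n) = \<sigma>\<^sub>n} = gibbs_dist q \<rho> h n \<sigma>\<^sub>n)"

definition translation_invariant_quasi_gibbs_measure ::
    "nat \<Rightarrow> 'p::prime_card padic \<Rightarrow> ((vertex \<Rightarrow> nat) set \<Rightarrow> 'p padic) \<Rightarrow> bool" where
  "translation_invariant_quasi_gibbs_measure q \<rho> \<mu> \<longleftrightarrow>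
     (\<exists>h. quasi_gibbs_measure q \<rho> h \<mu> \<and>
          (\<forall>x y. x \<noteq> tree_root \<longrightarrow> y \<noteq> tree_root \<longrightarrow> (\<forall>i<q. h x i = h y i)))"

end

theory Submission
  imports Defs
begin

text \<open>
  A constant boundary vector $g$ with $g_0 = 1$ defines a measure as soon as
  $(S - (1 - \rho) g_i)^3 = K g_i$ for all $i$, where $S = \sum_j g_j$ and $S, K \ne 0$: summing out
  one level of the tree then multiplies the weights by a power of $K$. One solution is $g = 1$. The
  other takes the value $x^3$ on $m$ spins and $1$ elsewhere, which leads to the cubic
  $m x^3 + (1 - \rho) (x^2 + x) + (q - m) = 0$. The paper's cubic is the case $m = 1$; for $m = p$,
  possible as $p^2 \mid q$, the reduction modulo $p$ is $x^2 + x$, whose simple root $-1$ lifts for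
  every $p$.
\<close>

section \<open>Configurations on the tree\<close>

lemma tree_V_eq: "tree_V n = {x. length x \<le> n}"
  by (auto simp: tree_V_def tree_W_def)

lemma finite_tree_W [simp]: "finite (tree_W n)"
  using finite_lists_length_eq[of "UNIV :: 3 set" n] by (simp add: tree_W_def)

lemma finite_tree_V [simp]: "finite (tree_V n)"
  by (simp add: tree_V_def)

lemma tree_V_Suc: "tree_V (Suc n) = tree_V n \<union> tree_W (Suc n)"
  by (auto simp: tree_V_eq tree_W_def)

lemma tree_V_Int_tree_W: "tree_V n \<inter> tree_W (Suc n) = {}"
  by (auto simp: tree_V_eq tree_W_def)

lemma tree_V_mono: "m \<le> n \<Longrightarrow> tree_V m \<subseteq> tree_V n"
  by (auto simp: tree_V_eq)

lemma finite_configs [simp]: "finite S \<Longrightarrow> finite (configs q S)"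
  by (simp add: configs_def finite_PiE)

lemma restrict_in_configs: "\<sigma> \<in> configs q T \<Longrightarrow> S \<subseteq> T \<Longrightarrow> restrict \<sigma> S \<in> configs q S"
  by (auto simp: configs_def PiE_iff)

lemma merge_in_configs:
  assumes "\<sigma> \<in> configs q (tree_V n)" "\<omega> \<in> configs q (tree_W (Suc n))"
  shows "merge (tree_V n) (tree_W (Suc n)) (\<sigma>, \<omega>) \<in> configs q (tree_V (Suc n))"
  using assms tree_V_Int_tree_W[of n] by (auto simp: configs_def tree_V_Suc)

lemma restrict_configs_id: "\<sigma> \<in> configs q S \<Longrightarrow> restrict \<sigma> S = \<sigma>"
  by (simp add: configs_def PiE_restrict)

text \<open>Restriction to \<open>tree_V n\<close> and \<open>tree_W (Suc n)\<close> inverts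
  \<open>merge\<close>, so configurations one level up are pairs. A general base \<open>B\<close>
  serves both the partition functions, where it is everything, and the consistency of values on
  cylinder sets.\<close>

lemma sum_configs_Suc:
  fixes f :: "(vertex \<Rightarrow> nat) \<Rightarrow> 'b::comm_monoid_add"
  assumes B: "B \<subseteq> configs q (tree_V n)"
  shows "(\<Sum>\<sigma> | \<sigma> \<in> configs q (tree_V (Suc n)) \<and> restrict \<sigma> (tree_V n) \<in> B. f \<sigma>) =
    (\<Sum>\<tau>\<in>B. \<Sum>\<omega>\<in>configs q (tree_W (Suc n)). f (merge (tree_V n) (tree_W (Suc n)) (\<tau>, \<omega>)))"
proof -
  let ?V = "tree_V n" and ?W = "tree_W (Suc n)"
  have "(\<Sum>\<sigma> | \<sigma> \<in> configs q (tree_V (Suc n)) \<and> restrict \<sigma> ?V \<in> B. f \<sigma>) =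
    (\<Sum>(\<tau>, \<omega>)\<in>B \<times> configs q ?W. f (merge ?V ?W (\<tau>, \<omega>)))"
  proof (rule sum.reindex_bij_witness[where i = "merge ?V ?W" and j = "\<lambda>\<sigma>. (restrict \<sigma> ?V, restrict \<sigma> ?W)"])
    fix \<sigma> assume \<sigma>: "\<sigma> \<in> {\<sigma>. \<sigma> \<in> configs q (tree_V (Suc n)) \<and> restrict \<sigma> ?V \<in> B}"
    \<comment> \<open>\<open>merge\<close> is \<open>undefined\<close> off both vertex sets; by
      extensionality \<sigma> agrees with it there.\<close>
    hence "\<sigma> x = undefined" if "x \<notin> ?V" "x \<notin> ?W" for x
      using that by (auto simp: configs_def tree_V_Suc PiE_iff extensional_def)
    thus 1: "merge ?V ?W (restrict \<sigma> ?V, restrict \<sigma> ?W) = \<sigma>"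
      by (auto simp: merge_def fun_eq_iff)
    show "(restrict \<sigma> ?V, restrict \<sigma> ?W) \<in> B \<times> configs q ?W"
      using \<sigma> restrict_in_configs[of \<sigma> q "tree_V (Suc n)" ?W] by (auto simp: tree_V_Suc)
    show "(case (restrict \<sigma> ?V, restrict \<sigma> ?W) of (\<tau>, \<omega>) \<Rightarrow> f (merge ?V ?W (\<tau>, \<omega>))) = f \<sigma>"
      by (simp only: 1 prod.case)
  next
    fix b assume b: "b \<in> B \<times> configs q ?W"
    obtain \<tau> \<omega> where [simp]: "b = (\<tau>, \<omega>)" by fastforce
    have \<tau>: "\<tau> \<in> configs q ?V" and \<omega>: "\<omega> \<in> configs q ?W" using b B by auto
    show "(restrict (merge ?V ?W b) ?V, restrict (merge ?V ?W b) ?W) = b"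
      using restrict_configs_id[OF \<tau>] restrict_configs_id[OF \<omega>] tree_V_Int_tree_W[of n] by simp
    show "merge ?V ?W b \<in> {\<sigma>. \<sigma> \<in> configs q (tree_V (Suc n)) \<and> restrict \<sigma> ?V \<in> B}"
      using b merge_in_configs[OF \<tau> \<omega>] restrict_configs_id[OF \<tau>] tree_V_Int_tree_W[of n] by simp
  qed
  also have "\<dots> = (\<Sum>\<tau>\<in>B. \<Sum>\<omega>\<in>configs q ?W. f (merge ?V ?W (\<tau>, \<omega>)))"
    by (simp add: sum.cartesian_product)
  finally show ?thesis .
qed

text \<open>The new edges are the pairs \<open>(tl y, y)\<close>, one for each new vertex y. The
  added energy is thus a sum of terms that each involve a single new spin, which lets the new spins
  be summed out independently.\<close>

lemma hamiltonian_merge: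
  "hamiltonian (Suc n) (merge (tree_V n) (tree_W (Suc n)) (\<sigma>, \<omega>)) =
    hamiltonian n \<sigma> + (\<Sum>y\<in>tree_W (Suc n). if \<sigma> (tl y) = \<omega> y then 1 else 0)"
proof -
  let ?m = "merge (tree_V n) (tree_W (Suc n)) (\<sigma>, \<omega>)"
  let ?E = "(\<lambda>y. (tl y, y)) ` tree_W (Suc n)"
  have L: "tree_L (Suc n) = tree_L n \<union> ?E"
    by (auto simp: tree_L_def tree_V_eq tree_W_def image_iff length_Suc_conv)
  have disj: "tree_L n \<inter> ?E = {}"
    by (auto simp: tree_L_def tree_V_eq tree_W_def)
  have fin: "finite (tree_L n)"
    by (rule finite_subset[of _ "tree_V n \<times> tree_V n"]) (auto simp: tree_L_def)
  have "hamiltonian (Suc n) ?m =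
      (\<Sum>(x, y)\<in>tree_L n. if ?m x = ?m y then 1 else 0) + (\<Sum>(x, y)\<in>?E. if ?m x = ?m y then 1 else 0)"
    unfolding hamiltonian_def L by (rule sum.union_disjoint) (use fin disj in auto)
  also have "(\<Sum>(x, y)\<in>tree_L n. if ?m x = ?m y then 1 else 0) = hamiltonian n \<sigma>"
    unfolding hamiltonian_def by (intro sum.cong) (auto simp: tree_L_def merge_def)
  also have "(\<Sum>(x, y)\<in>?E. if ?m x = ?m y then 1 else 0) =
      (\<Sum>y\<in>tree_W (Suc n). if ?m (tl y) = ?m y then 1 else (0::nat))"
    by (subst sum.reindex) (auto simp: inj_on_def)
  also have "\<dots> = (\<Sum>y\<in>tree_W (Suc n). if \<sigma> (tl y) = \<omega> y then 1 else 0)"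
    by (intro sum.cong) (auto simp: merge_def tree_V_eq tree_W_def)
  finally show ?thesis .
qed

text \<open>The map \<open>tl\<close> from \<open>tree_W (Suc n)\<close> onto
  \<open>tree_W n\<close> has fibres of size three. This is the origin of the cube in the
  recursion.\<close>

lemma prod_tree_W_Suc:
  fixes F :: "vertex \<Rightarrow> 'b::comm_monoid_mult"
  shows "(\<Prod>y\<in>tree_W (Suc n). F (tl y)) = (\<Prod>x\<in>tree_W n. F x ^ 3)"
proof -
  have "(\<Prod>y\<in>tree_W (Suc n). F (tl y)) = (\<Prod>(x, i)\<in>tree_W n \<times> (UNIV :: 3 set). F x)"
    by (rule prod.reindex_bij_witness[where i = "\<lambda>(x, i). i # x" and j = "\<lambda>y. (tl y, hd y)"])
       (auto simp: tree_W_def length_Suc_conv)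
  also have "\<dots> = (\<Prod>x\<in>tree_W n. \<Prod>i\<in>(UNIV :: 3 set). F x)"
    by (rule prod.cartesian_product[symmetric])
  finally show ?thesis by simp
qed


section \<open>Extension of consistent distributions to the cylinder algebra\<close>

definition cylinder :: "nat \<Rightarrow> nat \<Rightarrow> (vertex \<Rightarrow> nat) set \<Rightarrow> (vertex \<Rightarrow> nat) set" where
  "cylinder q n B = {\<sigma> \<in> configs q UNIV. restrict \<sigma> (tree_V n) \<in> B}"

text \<open>For q > 0 this recovers the base of a cylinder set from the set itself, so that values
  on sets can be defined without choosing a base.\<close>

definition cylinder_base :: "nat \<Rightarrow> (vertex \<Rightarrow> nat) set \<Rightarrow> (vertex \<Rightarrow> nat) set" where
  "cylinder_base n A = (\<lambda>\<sigma>. restrict \<sigma> (tree_V n)) ` A"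

lemma cylinder_sets_eq: "cylinder_sets q = {cylinder q n B | n B. B \<subseteq> configs q (tree_V n)}"
  by (simp add: cylinder_sets_def cylinder_def)

lemma cylinder_base_cylinder:
  assumes "q > 0" "B \<subseteq> configs q (tree_V n)"
  shows "cylinder_base n (cylinder q n B) = B"
proof
  show "B \<subseteq> cylinder_base n (cylinder q n B)"
  proof
    fix \<tau> assume \<tau>: "\<tau> \<in> B"
    \<comment> \<open>The witness extends \<tau> by spin 0, an admissible spin because q >
      0.\<close>
    define \<sigma> where "\<sigma> = (\<lambda>x. if x \<in> tree_V n then \<tau> x else 0)"
    have "restrict \<sigma> (tree_V n) = restrict \<tau> (tree_V n)" by (auto simp: \<sigma>_def fun_eq_iff)
    also have "\<dots> = \<tau>" using \<tau> assms(2) restrict_configs_id by blast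
    finally have r: "restrict \<sigma> (tree_V n) = \<tau>" .
    have "\<tau> \<in> configs q (tree_V n)" using \<tau> assms(2) by auto
    hence "\<sigma> \<in> configs q UNIV"
      using assms(1) by (auto simp: configs_def \<sigma>_def PiE_iff)
    thus "\<tau> \<in> cylinder_base n (cylinder q n B)"
      using r \<tau> by (auto simp: cylinder_base_def cylinder_def intro!: image_eqI[of _ _ \<sigma>])
  qed
qed (auto simp: cylinder_base_def cylinder_def)

lemma cylinder_lift:
  assumes "m \<le> n"
  shows "cylinder q m B = cylinder q n {\<sigma> \<in> configs q (tree_V n). restrict \<sigma> (tree_V m) \<in> B}"
proof -
  have "tree_V n \<inter> tree_V m = tree_V m" using tree_V_mono[OF assms] by auto
  thus ?thesis by (auto simp: cylinder_def restrict_in_configs)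
qed

lemma cylinder_sets_common:
  assumes "A \<in> cylinder_sets q" "A' \<in> cylinder_sets q"
  obtains n B B' where "n \<ge> 1" "B \<subseteq> configs q (tree_V n)" "B' \<subseteq> configs q (tree_V n)"
    "A = cylinder q n B" "A' = cylinder q n B'"
proof -
  obtain m C m' C' where C: "A = cylinder q m C" "A' = cylinder q m' C'"
    using assms by (auto simp: cylinder_sets_eq)
  \<comment> \<open>The level is kept at least 1, where the finite-volume distributions
    begin.\<close>
  define n where "n = max 1 (max m m')"
  have n: "m \<le> n" "m' \<le> n" "n \<ge> 1" by (auto simp: n_def)
  show ?thesis
    by (rule that[OF n(3) _ _ C(1)[unfolded cylinder_lift[OF n(1)]] C(2)[unfolded cylinder_lift[OF n(2)]]]) auto
qed

lemma algebra_cylinder_sets: "Sigma_Algebra.algebra (configs q UNIV) (cylinder_sets q)"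
  unfolding algebra_iff_Un
proof (intro conjI ballI)
  show "cylinder_sets q \<subseteq> Pow (configs q UNIV)" by (auto simp: cylinder_sets_eq cylinder_def)
  have "cylinder q 0 {} \<in> cylinder_sets q" by (auto simp: cylinder_sets_eq)
  thus "{} \<in> cylinder_sets q" by (simp add: cylinder_def)
  fix A assume A: "A \<in> cylinder_sets q"
  then obtain n B where B: "A = cylinder q n B" by (auto simp: cylinder_sets_eq)
  have "configs q UNIV - A = cylinder q n (configs q (tree_V n) - B)"
    by (auto simp: B cylinder_def restrict_in_configs)
  thus "configs q UNIV - A \<in> cylinder_sets q" by (auto simp: cylinder_sets_eq)
  fix A' assume "A' \<in> cylinder_sets q"
  with A obtain n B B' where B: "B \<subseteq> configs q (tree_V n)" "B' \<subseteq> configs q (tree_V n)"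
    "A = cylinder q n B" "A' = cylinder q n B'"
    by (rule cylinder_sets_common)
  have "A \<union> A' = cylinder q n (B \<union> B')" by (auto simp: B cylinder_def)
  thus "A \<union> A' \<in> cylinder_sets q" unfolding cylinder_sets_eq using B(1,2) by blast
qed

text \<open>Each cylinder set is determined at a finite level and only finite additivity is asked
  for, so no limit is involved. Consistency makes the sum over the base independent of the level,
  and additivity is that of finite sums at a common level.\<close>

lemma padic_measure_extension:
  fixes f :: "nat \<Rightarrow> (vertex \<Rightarrow> nat) \<Rightarrow> 'p::prime_card padic"
  assumes q: "q > 0"
    and cons: "\<And>n \<tau>. n \<ge> 1 \<Longrightarrow> \<tau> \<in> configs q (tree_V n) \<Longrightarrow>
      (\<Sum>\<omega>\<in>configs q (tree_W (Suc n)). f (Suc n) (merge (tree_V n) (tree_W (Suc n)) (\<tau>, \<omega>))) = f n \<tau>"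
    and total: "(\<Sum>\<sigma>\<in>configs q (tree_V 1). f 1 \<sigma>) = 1"
  obtains \<mu> where "padic_probability_measure (configs q UNIV) (cylinder_sets q) \<mu>"
    "\<And>n B. n \<ge> 1 \<Longrightarrow> B \<subseteq> configs q (tree_V n) \<Longrightarrow> \<mu> (cylinder q n B) = (\<Sum>\<sigma>\<in>B. f n \<sigma>)"
proof -
  define P where "P A n \<longleftrightarrow> n \<ge> 1 \<and> (\<exists>B. B \<subseteq> configs q (tree_V n) \<and> A = cylinder q n B)" for A n
  define M where "M n A = (\<Sum>\<sigma>\<in>cylinder_base n A. f n \<sigma>)" for n A
  \<comment> \<open>The least level is just a canonical choice; \<open>stable\<close> shows that
    every later level gives the same value.\<close>
  define \<mu> where "\<mu> A = M (LEAST n. P A n) A" for A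
  have M: "M n (cylinder q n B) = (\<Sum>\<sigma>\<in>B. f n \<sigma>)" if "B \<subseteq> configs q (tree_V n)" for n B
    using cylinder_base_cylinder[OF q that] by (simp add: M_def)
  have step: "P A (Suc n) \<and> M (Suc n) A = M n A" if "P A n" for A n
  proof -
    from that obtain B where B: "n \<ge> 1" "B \<subseteq> configs q (tree_V n)" "A = cylinder q n B"
      by (auto simp: P_def)
    let ?B = "{\<sigma> \<in> configs q (tree_V (Suc n)). restrict \<sigma> (tree_V n) \<in> B}"
    have A: "A = cylinder q (Suc n) ?B" unfolding B(3) by (rule cylinder_lift) simp
    have "M (Suc n) A = (\<Sum>\<sigma>\<in>?B. f (Suc n) \<sigma>)"
      unfolding A by (rule M) auto
    also have "\<dots> = (\<Sum>\<tau>\<in>B. f n \<tau>)"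
      unfolding sum_configs_Suc[OF B(2)] using B(1,2) by (intro sum.cong refl cons) auto
    also have "\<dots> = M n A" unfolding B(3) by (rule M[OF B(2), symmetric])
    finally have eq: "M (Suc n) A = M n A" .
    have "P A (Suc n)" unfolding P_def by (intro conjI exI[of _ ?B] A) auto
    with eq show ?thesis by blast
  qed
  have stable: "P A n \<and> M n A = M m A" if "P A m" "m \<le> n" for A m n
    using that(2) by (induction n rule: dec_induct) (use that(1) step in auto)
  have \<mu>: "\<mu> A = M n A" if "P A n" for A n
    using stable[OF LeastI[of "P A", OF that] Least_le[of "P A", OF that]] by (simp add: \<mu>_def)
  have \<mu>_cyl: "\<mu> (cylinder q n B) = (\<Sum>\<sigma>\<in>B. f n \<sigma>)" if "n \<ge> 1" "B \<subseteq> configs q (tree_V n)" for n B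
    using \<mu>[of "cylinder q n B" n] M[OF that(2)] that by (auto simp: P_def)
  have "additive (cylinder_sets q) \<mu>"
    unfolding additive_def
  proof (intro ballI impI)
    fix A A' assume A: "A \<in> cylinder_sets q" "A' \<in> cylinder_sets q" "A \<inter> A' = {}"
    obtain n B B' where B: "n \<ge> 1" "B \<subseteq> configs q (tree_V n)" "B' \<subseteq> configs q (tree_V n)"
      "A = cylinder q n B" "A' = cylinder q n B'"
      using A(1,2) by (rule cylinder_sets_common)
    \<comment> \<open>Disjointness passes from the cylinders to their bases, because a nonempty base
      has a nonempty cylinder.\<close>
    have "cylinder q n (B \<inter> B') = {}" using A(3) by (auto simp: B cylinder_def)
    hence "B \<inter> B' = {}"
      using cylinder_base_cylinder[OF q, of "B \<inter> B'" n] B(2) by (auto simp: cylinder_base_def)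
    moreover have "finite B" "finite B'" using B(2,3) by (auto intro: finite_subset)
    moreover have "A \<union> A' = cylinder q n (B \<union> B')" by (auto simp: B cylinder_def)
    ultimately show "\<mu> (A \<union> A') = \<mu> A + \<mu> A'"
      using B by (simp add: \<mu>_cyl sum.union_disjoint)
  qed
  moreover have "configs q UNIV = cylinder q 1 (configs q (tree_V 1))"
    by (auto simp: cylinder_def restrict_in_configs)
  hence "\<mu> (configs q UNIV) = 1" using \<mu>_cyl[of 1] total by simp
  ultimately show ?thesis
    using that[of \<mu>] \<mu>_cyl algebra_cylinder_sets by (simp add: padic_probability_measure_def)
qed


section \<open>Translation-invariant solutions\<close>

text \<open>Given \<sigma>, the new spins are independent, so the sum of products is a product of
  one-spin sums. The three successors of x contribute the cube of the sum belonging to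
  \<open>\<sigma> x\<close>, which the hypothesis turns into \<open>K * g (\<sigma> x)\<close>: the
  boundary product one level down reappears.\<close>

lemma sum_gibbs_weight_merge:
  fixes g :: "nat \<Rightarrow> 'a::field"
  assumes g: "\<And>i. i < q \<Longrightarrow> (\<Sum>j<q. (if i = j then \<rho> else 1) * g j) ^ 3 = K * g i"
    and \<sigma>: "\<sigma> \<in> configs q (tree_V n)"
  shows "(\<Sum>\<omega>\<in>configs q (tree_W (Suc n)).
      gibbs_weight \<rho> (\<lambda>_. g) (Suc n) (merge (tree_V n) (tree_W (Suc n)) (\<sigma>, \<omega>))) =
    K ^ card (tree_W n) * gibbs_weight \<rho> (\<lambda>_. g) n \<sigma>"
proof -
  let ?V = "tree_V n" and ?W = "tree_W (Suc n)"
  have w: "gibbs_weight \<rho> (\<lambda>_. g) (Suc n) (merge ?V ?W (\<sigma>, \<omega>)) =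
      \<rho> ^ hamiltonian n \<sigma> * (\<Prod>y\<in>?W. (if \<sigma> (tl y) = \<omega> y then \<rho> else 1) * g (\<omega> y))" for \<omega>
  proof -
    have "(\<Prod>y\<in>?W. g (merge ?V ?W (\<sigma>, \<omega>) y)) = (\<Prod>y\<in>?W. g (\<omega> y))"
      using tree_V_Int_tree_W[of n] by (intro prod.cong) auto
    moreover have "\<rho> ^ (\<Sum>y\<in>?W. if \<sigma> (tl y) = \<omega> y then 1 else 0) =
        (\<Prod>y\<in>?W. if \<sigma> (tl y) = \<omega> y then \<rho> else 1)"
      unfolding power_sum by (intro prod.cong) auto
    ultimately show ?thesis
      by (simp add: gibbs_weight_def hamiltonian_merge power_add prod.distrib)
  qed
  have "(\<Sum>\<omega>\<in>configs q ?W. gibbs_weight \<rho> (\<lambda>_. g) (Suc n) (merge ?V ?W (\<sigma>, \<omega>))) =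
      \<rho> ^ hamiltonian n \<sigma> * (\<Prod>y\<in>?W. \<Sum>j\<in>{0..<q}. (if \<sigma> (tl y) = j then \<rho> else 1) * g j)"
    unfolding w configs_def sum_distrib_left[symmetric] by (subst prod_sum_PiE) auto
  also have "(\<Prod>y\<in>?W. \<Sum>j\<in>{0..<q}. (if \<sigma> (tl y) = j then \<rho> else 1) * g j) =
      (\<Prod>x\<in>tree_W n. (\<Sum>j\<in>{0..<q}. (if \<sigma> x = j then \<rho> else 1) * g j) ^ 3)"
    by (rule prod_tree_W_Suc)
  also have "\<dots> = (\<Prod>x\<in>tree_W n. K * g (\<sigma> x))"
  proof (intro prod.cong refl)
    fix x assume "x \<in> tree_W n"
    hence "\<sigma> x < q" using \<sigma> by (auto simp: configs_def tree_V_eq tree_W_def PiE_iff)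
    thus "(\<Sum>j\<in>{0..<q}. (if \<sigma> x = j then \<rho> else 1) * g j) ^ 3 = K * g (\<sigma> x)"
      using g by (simp add: lessThan_atLeast0)
  qed
  also have "\<dots> = K ^ card (tree_W n) * (\<Prod>x\<in>tree_W n. g (\<sigma> x))"
    by (simp add: prod.distrib)
  finally show ?thesis by (simp add: gibbs_weight_def)
qed

text \<open>Starting value of the recursion for the partition functions: the root alone has no
  edges.\<close>

lemma partition_function_0: "partition_function q \<rho> (\<lambda>_. g) 0 = (\<Sum>i<q. g i)"
proof -
  have L: "tree_L 0 = {}" by (auto simp: tree_L_def tree_V_eq)
  have V: "tree_V 0 = {[]}" "tree_W 0 = {[]}" by (auto simp: tree_V_eq tree_W_def)
  have "partition_function q \<rho> (\<lambda>_. g) 0 = (\<Sum>\<sigma>\<in>{tree_root} \<rightarrow>\<^sub>E {0..<q}. g (\<sigma> tree_root))"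
    by (simp add: partition_function_def gibbs_weight_def hamiltonian_def L V configs_def)
  also have "\<dots> = (\<Sum>\<sigma>\<in>{tree_root} \<rightarrow>\<^sub>E {0..<q}. \<Prod>x\<in>{tree_root}. g (\<sigma> x))" by simp
  also have "\<dots> = (\<Prod>x\<in>{tree_root}. \<Sum>i\<in>{0..<q}. g i)"
    by (rule prod_sum_PiE[symmetric]) auto
  finally show ?thesis by (simp add: lessThan_atLeast0)
qed

lemma partition_function_Suc:
  fixes g :: "nat \<Rightarrow> 'a::field"
  assumes "\<And>i. i < q \<Longrightarrow> (\<Sum>j<q. (if i = j then \<rho> else 1) * g j) ^ 3 = K * g i"
  shows "partition_function q \<rho> (\<lambda>_. g) (Suc n) = K ^ card (tree_W n) * partition_function q \<rho> (\<lambda>_. g) n"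
proof -
  have "{\<sigma>. \<sigma> \<in> configs q (tree_V (Suc n)) \<and> restrict \<sigma> (tree_V n) \<in> configs q (tree_V n)} =
      configs q (tree_V (Suc n))"
    using restrict_in_configs tree_V_mono[of n "Suc n"] by auto
  with sum_configs_Suc[OF order_refl, of "gibbs_weight \<rho> (\<lambda>_. g) (Suc n)" q n] show ?thesis
    by (simp add: partition_function_def sum_gibbs_weight_merge[OF assms] sum_distrib_left)
qed

text \<open>Weights and partition functions pick up the same power of K, which cancels in
  \<open>gibbs_dist\<close> and gives compatibility. The partition functions are nonzero by
  induction, starting from the sum of g at level 0.\<close>

lemma constant_quasi_gibbs_measure:
  fixes \<rho> :: "'p::prime_card padic"
  assumes g: "\<And>i. i < q \<Longrightarrow> (\<Sum>j<q. (if i = j then \<rho> else 1) * g j) ^ 3 = K * g i"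
    and K: "K \<noteq> 0" and S: "(\<Sum>i<q. g i) \<noteq> 0" and g0: "g 0 = 1"
  obtains \<mu> where "quasi_gibbs_measure q \<rho> (\<lambda>_. g) \<mu>"
proof -
  have q: "q > 0" using S by (cases q) auto
  let ?Z = "partition_function q \<rho> (\<lambda>_. g)"
  have Z: "?Z n \<noteq> 0" for n
    by (induction n) (use S K in \<open>simp_all add: partition_function_0 partition_function_Suc[OF g]\<close>)
  have cons: "(\<Sum>\<omega>\<in>configs q (tree_W (Suc n)).
      gibbs_dist q \<rho> (\<lambda>_. g) (Suc n) (merge (tree_V n) (tree_W (Suc n)) (\<sigma>, \<omega>))) =
    gibbs_dist q \<rho> (\<lambda>_. g) n \<sigma>" if "\<sigma> \<in> configs q (tree_V n)" for n \<sigma>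
    unfolding gibbs_dist_def sum_distrib_left[symmetric]
    using K by (simp add: sum_gibbs_weight_merge[OF g that] partition_function_Suc[OF g])
  have compat: "compatible q \<rho> (\<lambda>_. g)"
    unfolding compatible_def
  proof (intro allI impI ballI)
    fix n :: nat and \<sigma> assume "n \<ge> 2" "\<sigma> \<in> configs q (tree_V (n - 1))"
    thus "(\<Sum>\<omega>\<in>configs q (tree_W n). gibbs_dist q \<rho> (\<lambda>_. g) n (merge (tree_V (n - 1)) (tree_W n) (\<sigma>, \<omega>))) =
      gibbs_dist q \<rho> (\<lambda>_. g) (n - 1) \<sigma>"
      using cons[of \<sigma> "n - 1"] by simp
  qed
  have "(\<Sum>\<sigma>\<in>configs q (tree_V 1). gibbs_dist q \<rho> (\<lambda>_. g) 1 \<sigma>) = 1"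
    unfolding gibbs_dist_def sum_distrib_left[symmetric]
    using Z[of 1] by (simp add: partition_function_def)
  from padic_measure_extension[OF q cons this] obtain \<mu>
    where \<mu>: "padic_probability_measure (configs q UNIV) (cylinder_sets q) \<mu>"
      "\<And>n B. n \<ge> 1 \<Longrightarrow> B \<subseteq> configs q (tree_V n) \<Longrightarrow>
        \<mu> (cylinder q n B) = (\<Sum>\<sigma>\<in>B. gibbs_dist q \<rho> (\<lambda>_. g) n \<sigma>)"
    by blast
  have "\<mu> {\<sigma> \<in> configs q UNIV. restrict \<sigma> (tree_V n) = \<sigma>\<^sub>n} = gibbs_dist q \<rho> (\<lambda>_. g) n \<sigma>\<^sub>n"
    if "n \<ge> 1" "\<sigma>\<^sub>n \<in> configs q (tree_V n)" for n \<sigma>\<^sub>n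
    using \<mu>(2)[of n "{\<sigma>\<^sub>n}"] that by (simp add: cylinder_def)
  hence "quasi_gibbs_measure q \<rho> (\<lambda>_. g) \<mu>"
    unfolding quasi_gibbs_measure_def using Z compat \<mu>(1) g0 by simp
  thus ?thesis by (rule that)
qed

section \<open>Translation invariance and separation of the measures\<close>

lemma translation_invariant_constant:
  "quasi_gibbs_measure q \<rho> (\<lambda>_. g) \<mu> \<Longrightarrow> translation_invariant_quasi_gibbs_measure q \<rho> \<mu>"
  unfolding translation_invariant_quasi_gibbs_measure_def by (intro exI[of _ "\<lambda>_. g"]) auto

text \<open>The measures themselves must differ, not only the boundary vectors. Two level-1
  cylinders suffice: spin 1 forces equal partition functions if the measures agree, and then spin j
  forces \<open>g' j = 1\<close>.\<close>

lemma quasi_gibbs_measures_differ: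
  fixes \<rho> :: "'p::prime_card padic"
  assumes \<mu>: "quasi_gibbs_measure q \<rho> (\<lambda>_. g) \<mu>" and \<mu>': "quasi_gibbs_measure q \<rho> (\<lambda>_. g') \<mu>'"
    and g: "g 1 = 1" "g j = 1" and g': "g' 1 = 1" "g' j \<noteq> 1" and j: "1 < j" "j < q"
  shows "\<exists>A\<in>cylinder_sets q. \<mu> A \<noteq> \<mu>' A"
proof (rule ccontr)
  assume "\<not> ?thesis"
  hence eq: "\<mu> A = \<mu>' A" if "A \<in> cylinder_sets q" for A using that by blast
  \<comment> \<open>The root has spin 0 and its successors have nonzero spins when
    \<open>i \<noteq> 0\<close>, so no edge contributes and \<rho> drops out. Two successors carry
    spin 1, of boundary value 1, which leaves the value at i as the whole weight.\<close>
  define \<sigma> where "\<sigma> i = (\<lambda>x\<in>tree_V 1. if x = [] then 0 else if x = [0] then i else 1)" for i :: nat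
  have \<sigma>: "\<sigma> i \<in> configs q (tree_V 1)" if "i < q" for i
    using that j by (auto simp: \<sigma>_def configs_def)
  have "hamiltonian 1 (\<sigma> i) = 0" if "i \<noteq> 0" for i
    unfolding hamiltonian_def using that
    by (intro sum.neutral ballI) (auto simp: \<sigma>_def tree_L_def tree_V_eq)
  moreover have "(\<Prod>x\<in>tree_W 1. f (\<sigma> i x)) = f i" if "f 1 = 1" for f :: "nat \<Rightarrow> 'p padic" and i
  proof -
    have "(\<Prod>x\<in>tree_W 1 - {[0]}. f (\<sigma> i x)) = 1"
      using that by (intro prod.neutral ballI) (auto simp: \<sigma>_def tree_W_def tree_V_eq)
    moreover have "\<sigma> i [0] = i" by (simp add: \<sigma>_def tree_V_eq)
    ultimately show ?thesis by (subst prod.remove[of _ "[0]"]) (simp_all, simp add: tree_W_def)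
  qed
  ultimately have weight: "gibbs_weight \<rho> (\<lambda>_. f) 1 (\<sigma> i) = f i" if "f 1 = 1" "i \<noteq> 0" for f i
    using that by (simp add: gibbs_weight_def)
  have "gibbs_dist q \<rho> (\<lambda>_. g) 1 (\<sigma> i) = gibbs_dist q \<rho> (\<lambda>_. g') 1 (\<sigma> i)" if "i < q" for i
  proof -
    have "cylinder q 1 {\<sigma> i} \<in> cylinder_sets q" using \<sigma>[OF that] by (auto simp: cylinder_sets_eq)
    from eq[OF this] show ?thesis
      using \<mu> \<mu>' \<sigma>[OF that] by (simp add: quasi_gibbs_measure_def cylinder_def)
  qed
  from this[of 1] this[of j] have "1 / partition_function q \<rho> (\<lambda>_. g) 1 = 1 / partition_function q \<rho> (\<lambda>_. g') 1"
    "1 / partition_function q \<rho> (\<lambda>_. g) 1 = g' j / partition_function q \<rho> (\<lambda>_. g') 1"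
    using j g g' by (simp_all add: gibbs_dist_def weight del: One_nat_def)
  moreover have "partition_function q \<rho> (\<lambda>_. g') 1 \<noteq> 0"
    using \<mu>' by (simp add: quasi_gibbs_measure_def)
  ultimately show False using g'(2) by (simp add: frac_eq_eq del: One_nat_def)
qed


section \<open>Lifting a root to the p-adic numbers\<close>

text \<open>Dictionary between norm bounds and divisibility: k = 2 reads off
  \<open>CARD('p) ^ 2 dvd q\<close>, and k = 1 recognises the naturals divisible by the
  prime.\<close>

lemma padic_norm_of_nat_le_iff:
  assumes "n \<noteq> 0"
  shows "padic_norm (of_nat n :: 'p::prime_card padic) \<le> real CARD('p) powi (- int k) \<longleftrightarrow> CARD('p) ^ k dvd n"
proof -
  have p: "prime CARD('p)" by (rule prime_card)
  have "padic_val CARD('p) (of_int (int n) / of_int 1) = int (multiplicity (int CARD('p)) (int n))"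
    using assms p by (subst padic_val_frac) auto
  hence "padic_norm (of_nat n :: 'p padic) = real CARD('p) powi (- int (multiplicity (int CARD('p)) (int n)))"
    using assms by (simp add: padic_norm_of_nat padic_abs_def)
  moreover have "real CARD('p) > 1" using prime_gt_1_nat[OF p] by simp
  ultimately have "padic_norm (of_nat n :: 'p padic) \<le> real CARD('p) powi (- int k) \<longleftrightarrow>
      k \<le> multiplicity (int CARD('p)) (int n)"
    using power_int_strict_increasing[of "- int k" "- int (multiplicity (int CARD('p)) (int n))" "real CARD('p)"]
      power_int_increasing[of "- int (multiplicity (int CARD('p)) (int n))" "- int k" "real CARD('p)"]
    by (cases "k \<le> multiplicity (int CARD('p)) (int n)") auto
  also have "\<dots> \<longleftrightarrow> int CARD('p) ^ k dvd int n"
    using assms p by (intro power_dvd_iff_le_multiplicity[symmetric]) auto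
  also have "\<dots> \<longleftrightarrow> CARD('p) ^ k dvd n"
    by (simp flip: of_nat_power)
  finally show ?thesis .
qed

section \<open>Ultrametric estimates\<close>

lemma padic_norm_add_le:
  "padic_norm x \<le> r \<Longrightarrow> padic_norm y \<le> r \<Longrightarrow> padic_norm (x + y :: 'p::prime_card padic) \<le> r"
  using padic_norm_ultrametric[of x y] by simp

lemma padic_norm_diff_le:
  "padic_norm x \<le> r \<Longrightarrow> padic_norm y \<le> r \<Longrightarrow> padic_norm (x - y :: 'p::prime_card padic) \<le> r"
  using padic_norm_diff_ultrametric[of x y] by simp

lemma padic_norm_mult_le:
  "padic_norm x \<le> r \<Longrightarrow> padic_norm y \<le> 1 \<Longrightarrow> padic_norm (x * y :: 'p::prime_card padic) \<le> r"
  using mult_mono[of "padic_norm x" r "padic_norm y" 1] padic_norm_nonneg[of x] padic_norm_nonneg[of y]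
  by (simp add: padic_norm_mult del: padic_norm_nonneg)

lemma padic_norm_one_minus:
  fixes x :: "'p::prime_card padic"
  assumes "padic_norm x < 1"
  shows "padic_norm (1 - x) = 1"
  using padic_norm_diff_ultrametric[of 1 x] padic_norm_ultrametric[of "1 - x" x] assms by simp

lemma padic_norm_inverse: "padic_norm (inverse x :: 'p::prime_card padic) = inverse (padic_norm x)"
proof (cases "x = 0")
  case False
  hence "padic_norm x * padic_norm (inverse x) = 1"
    using padic_norm_mult[of x "inverse x"] by simp
  thus ?thesis by (metis inverse_unique)
qed auto

text \<open>
  Modulo $P$ and $Q$ the equation reads $y (1 - y) = 0$; the root near the simple root $0$ is the
  fixed point of $y \mapsto y^2 + (P (y - 1)^3 + Q) / e$.
\<close>

lemma padic_perturbed_root: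
  fixes P Q e :: "'p::prime_card padic"
  assumes P: "padic_norm P \<le> r" and Q: "padic_norm Q \<le> r" and r: "r < 1" and e: "padic_norm e = 1"
  obtains y where "padic_norm y \<le> r" "e * (y * (1 - y)) = P * (y - 1) ^ 3 + Q"
proof -
  define S where "S = {y :: 'p padic. padic_norm y \<le> r}"
  define F where "F y = y * y + inverse e * (P * (y - 1) ^ 3 + Q)" for y
  have r0: "0 \<le> r" using P padic_norm_nonneg[of P] by linarith
  have e0: "e \<noteq> 0" using e by auto
  have ie: "padic_norm (inverse e) \<le> 1" using e by (simp add: padic_norm_inverse)
  have S1: "padic_norm (y - 1) \<le> 1" if "y \<in> S" for y
    using that r by (intro padic_norm_diff_le) (auto simp: S_def)
  \<comment> \<open>As a closed ball of the complete space of p-adic numbers, S admits the Banach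
    fixed point theorem.\<close>
  have "S = cball 0 r" by (auto simp: S_def dist_padic_def)
  hence "complete S" by (simp add: complete_eq_closed)
  moreover have "S \<noteq> {}" using r0 by (auto simp: S_def intro!: exI[of _ 0])
  moreover have "F ` S \<subseteq> S"
  proof (rule image_subsetI)
    fix y assume y: "y \<in> S"
    hence yr: "padic_norm y \<le> r" by (simp add: S_def)
    have "padic_norm ((y - 1) ^ 3) \<le> 1"
      unfolding power3_eq_cube by (intro padic_norm_mult_le S1 y)
    hence "padic_norm ((P * (y - 1) ^ 3 + Q) * inverse e) \<le> r"
      by (intro padic_norm_mult_le[of _ r] padic_norm_add_le P Q ie) auto
    moreover have "padic_norm (y * y) \<le> r"
      using yr r by (intro padic_norm_mult_le) auto
    ultimately show "F y \<in> S"
      by (simp add: S_def F_def mult.commute padic_norm_add_le)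
  qed
  moreover have "dist (F x) (F y) \<le> r * dist x y" if x: "x \<in> S" and y: "y \<in> S" for x y
  proof -
    \<comment> \<open>The cofactor of \<open>x - y\<close> in \<open>F x - F y\<close>, from
      factoring the differences of squares and of cubes. Each of its terms has a factor x, y or P of
      norm at most r, so r is a contraction constant.\<close>
    let ?B = "(x + y) + P * ((x - 1) * (x - 1) + (x - 1) * (y - 1) + (y - 1) * (y - 1)) * inverse e"
    have "F x - F y = ?B * (x - y)"
      unfolding F_def power3_eq_cube by (simp add: algebra_simps)
    moreover have "padic_norm ?B \<le> r"
      using x y by (intro padic_norm_add_le[of _ r] padic_norm_mult_le[of _ r] padic_norm_add_le[of _ 1]
          padic_norm_mult_le[of _ 1] P ie S1) (auto simp: S_def)
    ultimately show ?thesis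
      by (simp add: dist_padic_def padic_norm_mult mult_right_mono)
  qed
  ultimately obtain y where y: "y \<in> S" "F y = y"
    using Banach_fix[of S r F] r0 r by blast
  have "e * y = e * (y * y) + (P * (y - 1) ^ 3 + Q)"
    using y(2) e0 by (simp add: F_def field_simps)
  hence "e * (y * (1 - y)) = P * (y - 1) ^ 3 + Q"
    by (simp add: algebra_simps)
  with y(1) show ?thesis using that by (simp add: S_def)
qed


section \<open>Two solutions of the recursion\<close>

lemma sum_potts_factor:
  fixes g :: "nat \<Rightarrow> 'a::field"
  assumes "i < q"
  shows "(\<Sum>j<q. (if i = j then \<rho> else 1) * g j) = (\<Sum>j<q. g j) - (1 - \<rho>) * g i"
proof -
  have "(\<Sum>j<q. (if i = j then \<rho> else 1) * g j) = (\<Sum>j<q. g j - (if i = j then (1 - \<rho>) * g j else 0))"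
    by (intro sum.cong) (auto simp: algebra_simps)
  also have "\<dots> = (\<Sum>j<q. g j) - (1 - \<rho>) * g i"
    using assms by (simp add: sum_subtractf)
  finally show ?thesis .
qed

text \<open>K is nonzero because q + \<rho> has norm below 1. The sum of the boundary values is q,
  which is p-adically small but nonzero in characteristic zero.\<close>

lemma uniform_quasi_gibbs_measure:
  fixes \<rho> :: "'p::prime_card padic"
  assumes \<rho>: "padic_norm \<rho> < 1" and q: "padic_norm (of_nat q :: 'p padic) < 1" "q > 0"
  obtains \<mu> where "quasi_gibbs_measure q \<rho> (\<lambda>_ _. 1) \<mu>"
proof (rule constant_quasi_gibbs_measure)
  let ?K = "(of_nat q - (1 - \<rho>)) ^ 3"
  show "(\<Sum>j<q. (if i = j then \<rho> else 1) * 1) ^ 3 = ?K * 1" if "i < q" for i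
    using sum_potts_factor[OF that, of \<rho> "\<lambda>_. 1"] by simp
  have "of_nat q + \<rho> \<noteq> 1"
    using padic_norm_ultrametric[of "of_nat q" \<rho>] \<rho> q(1) by auto
  thus "?K \<noteq> 0" by (simp add: algebra_simps)
qed (use q in auto)

text \<open>
  With weight $x^3$ on $p$ of the spins and $1$ on the others, the recursion asks for
  $S - (1 - \rho) x^3 = x (S - (1 - \rho))$, that is, for $S = - (1 - \rho) x (1 + x)$ when $x \ne 1$.
  In the proof $y = x + 1$ is the small root and $e = 1 - \rho$.
\<close>

lemma two_valued_quasi_gibbs_measure:
  fixes \<rho> :: "'p::prime_card padic"
  assumes \<rho>: "padic_norm \<rho> < 1" and p: "CARD('p) > 3" and q: "CARD('p) ^ 2 dvd q" "q > 0"
  obtains t \<mu> where "t \<noteq> 1"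
    "quasi_gibbs_measure q \<rho> (\<lambda>_ i. if i \<in> {2..<CARD('p) + 2} then t else 1) \<mu>"
proof -
  define p where "p = CARD('p)"
  define r where "r = 1 / real p"
  have r: "r < 1" using p by (simp add: r_def p_def)
  have small: "padic_norm (of_nat n :: 'p padic) \<le> r \<longleftrightarrow> p dvd n" if "n \<noteq> 0" for n
    using padic_norm_of_nat_le_iff[where ?'p = 'p, OF that, of 1]
    by (simp add: r_def p_def power_int_minus field_simps)
  have "p ^ 2 \<le> q" using q by (auto simp: p_def intro: dvd_imp_le)
  moreover have "p * 4 \<le> p * p" using p by (intro mult_left_mono) (auto simp: p_def)
  \<comment> \<open>Room for a block of p spins besides the spins 0 and 1.\<close>
  ultimately have q_large: "p + 2 < q" using p unfolding p_def power2_eq_square by linarith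
  have pdvd: "p dvd q - p"
    using q(1) by (metis dvd_diff_nat dvd_refl dvd_trans dvd_triv_left p_def power2_eq_square)
  define e where "e = 1 - \<rho>"
  have e: "padic_norm e = 1" using padic_norm_one_minus[OF \<rho>] by (simp add: e_def)
  \<comment> \<open>The perturbation has P = p and Q = q - p, both divisible by p.\<close>
  have "padic_norm (of_nat p :: 'p padic) \<le> r" "padic_norm (of_nat (q - p) :: 'p padic) \<le> r"
    using small[of p] small[of "q - p"] q_large pdvd p by (auto simp: p_def)
  from padic_perturbed_root[OF this r e] obtain y :: "'p padic"
    where y: "padic_norm y \<le> r" and
      root: "e * (y * (1 - y)) = of_nat p * (y - 1) ^ 3 + of_nat (q - p)"
    by blast
  define x where "x = y - 1"
  define t where "t = x ^ 3"
  \<comment> \<open>The block starts at 2: spin 0 keeps the normalization, and spin 1 keeps the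
    value 1 used to separate the measures.\<close>
  define g where "g i = (if i \<in> {2..<p + 2} then t else 1)" for i
  define S where "S = (\<Sum>i<q. g i)"
  \<comment> \<open>Excludes x = 1, which would return the uniform solution: 2 has norm 1 as p > 3,
    while y has norm at most 1/p.\<close>
  have "y \<noteq> 2"
    using small[of 2] y p by (auto simp: p_def dest: dvd_imp_le)
  hence x1: "x \<noteq> 1" by (simp add: x_def algebra_simps)
  \<comment> \<open>Needed for \<open>S \<noteq> 0\<close>. At y = 0 the equation collapses to q =
    2p, against the divisibility of q by the square of p.\<close>
  have "y \<noteq> 0"
  proof
    assume "y = 0"
    hence "(of_nat (q - p) :: 'p padic) = of_nat p" using root by simp
    hence "q = 2 * p" using q_large by (simp only: of_nat_eq_iff)
    hence "p dvd 2" using q(1) p by (auto simp: p_def power2_eq_square)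
    thus False using p by (auto simp: p_def dest: dvd_imp_le)
  qed
  have y1: "padic_norm (y * (1 - y)) \<le> r"
    using y r by (intro padic_norm_mult_le padic_norm_diff_le) auto
  \<comment> \<open>Used twice: x is not a primitive cube root of unity, so
    \<open>t \<noteq> 1\<close>, and the constant K = \<open>(S - e) ^ 3\<close> does not
    vanish.\<close>
  have c: "x * x + x + 1 \<noteq> 0"
  proof
    assume "x * x + x + 1 = 0"
    moreover have "x * x + x + 1 = 1 - y * (1 - y)" by (simp add: x_def algebra_simps)
    ultimately have "y * (1 - y) = 1" by simp
    with y1 r show False by simp
  qed
  have t1: "t \<noteq> 1"
  proof
    assume "t = 1"
    moreover have "(x - 1) * (x * x + x + 1) = t - 1"
      by (simp add: t_def power3_eq_cube algebra_simps)
    ultimately have "(x - 1) * (x * x + x + 1) = 0" by simp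
    with x1 c show False by simp
  qed
  have "S = (\<Sum>i\<in>{2..<p + 2}. g i) + (\<Sum>i\<in>{..<q} - {2..<p + 2}. g i)"
    unfolding S_def using q_large by (subst sum.subset_diff[of "{2..<p + 2}"]) auto
  also have "(\<Sum>i\<in>{2..<p + 2}. g i) = of_nat p * t" by (simp add: g_def)
  also have "(\<Sum>i\<in>{..<q} - {2..<p + 2}. g i) = (\<Sum>i\<in>{..<q} - {2..<p + 2}. 1)"
    by (intro sum.cong) (auto simp: g_def)
  also have "\<dots> = of_nat (q - p)"
    using q_large card_Diff_subset[of "{2..<p + 2}" "{..<q}"] by (simp add: subset_iff)
  finally have S: "S = e * (y * (1 - y))"
    using root by (simp add: t_def x_def)
  have "S \<noteq> 0" using S e \<open>y \<noteq> 0\<close> y r by auto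
  have "S - e = - e * (x * x + x + 1)" by (simp add: S x_def algebra_simps)
  hence "S - e \<noteq> 0" using c e by auto
  have "(\<Sum>j<q. (if i = j then \<rho> else 1) * g j) ^ 3 = (S - e) ^ 3 * g i" if "i < q" for i
  proof -
    \<comment> \<open>Cubing this settles the spins of value t = \<open>x ^ 3\<close>; for spins of
      value 1 the recursion holds by the choice of K.\<close>
    have "S - e * x ^ 3 = (S - e) * x" by (simp add: S x_def power3_eq_cube algebra_simps)
    thus ?thesis
      unfolding sum_potts_factor[OF that] e_def[symmetric] S_def[symmetric]
      by (simp add: g_def t_def power_mult_distrib)
  qed
  moreover have "(S - e) ^ 3 \<noteq> 0" using \<open>S - e \<noteq> 0\<close> by simp
  moreover have "(\<Sum>i<q. g i) \<noteq> 0" using \<open>S \<noteq> 0\<close> by (simp add: S_def)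
  moreover have "g 0 = 1" by (simp add: g_def)
  ultimately obtain \<mu> where "quasi_gibbs_measure q \<rho> (\<lambda>_. g) \<mu>"
    by (rule constant_quasi_gibbs_measure)
  hence "quasi_gibbs_measure q \<rho> (\<lambda>_ i. if i \<in> {2..<CARD('p) + 2} then t else 1) \<mu>"
    unfolding g_def p_def .
  thus ?thesis by (rule that[OF t1])
qed

theorem theorem4p5:
  fixes \<rho> :: "'p::prime_card padic" and p q :: nat
  assumes "p = CARD('p)" and "p > 3" and "q \<ge> 3"
    and "padic_norm \<rho> \<le> real p powi (-2)"
    and "padic_norm (of_nat q :: 'p padic) \<le> real p powi (-2)"
    and "p = 11 \<or> p = 19 \<or>
      (p \<noteq> 11 \<and> p \<noteq> 19 \<and>
       (\<exists>(a\<^sub>0::int) (b\<^sub>0::int) (D\<^sub>0::int) (u :: nat \<Rightarrow> int).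
          a\<^sub>0 \<in> {1..int p - 1} \<and> b\<^sub>0 \<in> {1..int p - 1} \<and>
          [3 * a\<^sub>0 = - 4] (mod int p) \<and> [27 * b\<^sub>0 = - 38] (mod int p) \<and>
          D\<^sub>0 = - 4 * a\<^sub>0 ^ 3 - 27 * b\<^sub>0 ^ 2 \<and>
          u 1 = 0 \<and> u 2 = - a\<^sub>0 \<and> u 3 = b\<^sub>0 \<and>
          (\<forall>n\<ge>1. u (n + 3) = b\<^sub>0 * u n - a\<^sub>0 * u (n + 1)) \<and>
          \<not> [D\<^sub>0 * u (p - 2) ^ 2 = 0] (mod int p) \<and>
          \<not> [D\<^sub>0 * u (p - 2) ^ 2 = 9 * a\<^sub>0 ^ 2] (mod int p)))"
  shows "\<exists>\<mu>\<^sub>1 \<mu>\<^sub>2.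
    translation_invariant_quasi_gibbs_measure q \<rho> \<mu>\<^sub>1 \<and>
    translation_invariant_quasi_gibbs_measure q \<rho> \<mu>\<^sub>2 \<and>
    (\<exists>A\<in>cylinder_sets q. \<mu>\<^sub>1 A \<noteq> \<mu>\<^sub>2 A)"
proof -
  have p: "real p > 1" using assms(2) by simp
  hence small: "real p powi (-2) < 1"
    by (simp add: power_int_minus field_simps)
  have "CARD('p) ^ 2 dvd q"
    using padic_norm_of_nat_le_iff[where ?'p = 'p, of q 2] assms(1,3,5) by simp
  moreover have \<rho>: "padic_norm \<rho> < 1" and q: "padic_norm (of_nat q :: 'p padic) < 1"
    using assms(4,5) small by linarith+
  ultimately obtain t \<mu>\<^sub>2 where t: "t \<noteq> 1"
    and \<mu>\<^sub>2: "quasi_gibbs_measure q \<rho> (\<lambda>_ i. if i \<in> {2..<CARD('p) + 2} then t else 1) \<mu>\<^sub>2"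
    using two_valued_quasi_gibbs_measure[of \<rho> q thesis] assms(1-3) by simp
  obtain \<mu>\<^sub>1 where \<mu>\<^sub>1: "quasi_gibbs_measure q \<rho> (\<lambda>_ _. 1) \<mu>\<^sub>1"
    using uniform_quasi_gibbs_measure[OF \<rho> q, of thesis] assms(3) by simp
  \<comment> \<open>Spin 2 is the first with value t, and it occurs since
    \<open>q \<ge> 3\<close>.\<close>
  have "\<exists>A\<in>cylinder_sets q. \<mu>\<^sub>1 A \<noteq> \<mu>\<^sub>2 A"
    by (rule quasi_gibbs_measures_differ[OF \<mu>\<^sub>1 \<mu>\<^sub>2, of 2]) (use t assms(1-3) in auto)
  thus ?thesis
    using translation_invariant_constant[OF \<mu>\<^sub>1] translation_invariant_constant[OF \<mu>\<^sub>2] by blast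
qed

end
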